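(* For every integer $d\ge1$, the polytope $P_d=P_d(132,213)$ is combinatorially a $(d-1)$-cube (its face lattice is isomorphic to that of the $(d-1)$-dimensional cube) and $$\operatorname{Vol}_{\mathrm{norm}}P_d(132,213)=2^{d-1}d^{d-3},$$ where for $d=1$ the normalized volume of a lattice point is $1$. Moreover, $P_d(132,213)$ is lattice equivalent to $2(\Pi_{\mathcal C_d}-\mathbf 1)$, where $\mathcal C_d$ is the chain $1<\cdots<d$, $\Pi_{\mathcal C_d}$ is its poset permutahedron, and $\mathbf 1=(1,\ldots,1)$.
   Context: $P_d(132,213)\subset\mathbb R^d$ is the convex hull of the points $(\pi_1,\ldots,\pi_d)$ over all permutations $\pi$ of $\{1,\ldots,d\}$ that avoid both patterns $132$ and $213$ (a permutation avoids a pattern if no subsequence has the same relative order as the pattern). It lies in the affine hyperplane $\sum_i x_i=d(d+1)/2$. Normalized volume is measured with respect to the difference lattice $\{z\in\mathbb Z^d:\sum_i z_i=0\}$, scaled so that a unimodular simplex (of dimension $d-1$) has volume $1$. The translated chain-poset permutahedron $R_d=\Pi_{\mathcal C_d}-\mathbf 1$ is the set of $a\in\mathbb R^d$ with $a_1\le\cdots\le a_d$, $\sum_{i=1}^d a_i=\binom d2$, and $\sum_{i=1}^k a_i\ge\binom k2$ for $1\le k<d$; thus $2R_d$ is given by $a_1\le\cdots\le a_d$, $\sum_{i=1}^d a_i=2\binom d2$, $\sum_{i=1}^k a_i\ge2\binom k2$ for $1\le k<d$. Two polytopes are lattice equivalent if there is an affine isomorphism between their affine hulls that maps the integer points of one affine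 hull bijectively onto the integer points of the other and maps one polytope onto the other. Here the affine lattices are $\{x\in\mathbb Z^d:\sum_i x_i=d(d+1)/2\}$ and $\{a\in\mathbb Z^d:\sum_i a_i=d(d-1)\}$. *)

theory Defs
  imports
    "HOL-Analysis.Analysis"
    "HOL-Combinatorics.Multiset_Permutations"
    "HOL-Library.Sublist"
begin

text \<open>
  The space $\mathbb{R}^d$ is \<^typ>\<open>real ^ 'n\<close> for a finite well-ordered index type \<open>'n\<close> with
  \<open>d = CARD('n)\<close>; being nonempty, \<open>'n\<close> ranges over exactly the cardinalities \<open>d \<ge> 1\<close>. The order
  on \<open>'n\<close> numbers the coordinates: \<open>i\<close> is coordinate number \<open>coord_pos i + 1\<close>.
\<close>

definition coord_pos :: "'n::{finite,wellorder} \<Rightarrow> nat" where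
  "coord_pos i = card {j. j < i}"

definition vec_of_list :: "nat list \<Rightarrow> real ^ 'n::{finite,wellorder}" where
  "vec_of_list w = (\<chi> i. real (w ! coord_pos i))"


subsection \<open>Pattern avoidance\<close>

text \<open>Permutations and patterns are words in one-line notation.\<close>

definition same_relative_order :: "nat list \<Rightarrow> nat list \<Rightarrow> bool" where
  "same_relative_order u v \<longleftrightarrow> length u = length v \<and>
     (\<forall>i < length u. \<forall>j < length u. u ! i < u ! j \<longleftrightarrow> v ! i < v ! j)"

definition avoids :: "nat list \<Rightarrow> nat list \<Rightarrow> bool" where
  "avoids w v \<longleftrightarrow> \<not> (\<exists>u. subseq u w \<and> same_relative_order u v)"

definition avoiding_permutations :: "nat \<Rightarrow> nat list set \<Rightarrow> nat list set" where
  "avoiding_permutations d V = {w \<in> permutations_of_set {1..d}. \<forall>v \<in> V. avoids w v}"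

definition avoidance_polytope :: "nat list set \<Rightarrow> (real ^ 'n::{finite,wellorder}) set" where
  "avoidance_polytope V = convex hull (vec_of_list ` avoiding_permutations CARD('n) V)"


subsection \<open>Combinatorial type\<close>

text \<open>The faces include the empty face and the polytope itself.\<close>

definition combinatorially_equivalent ::
  "'a::real_vector set \<Rightarrow> 'b::real_vector set \<Rightarrow> bool" where
  "combinatorially_equivalent P Q \<longleftrightarrow>
     (\<exists>\<phi>. bij_betw \<phi> {F. F face_of P} {G. G face_of Q} \<and>
          (\<forall>F G. F face_of P \<longrightarrow> G face_of P \<longrightarrow> (F \<subseteq> G \<longleftrightarrow> \<phi> F \<subseteq> \<phi> G)))"

text \<open>The \<open>k\<close>-dimensional cube $[0,1]^k \times \{0\}^{d-k}$, for $k \le d$. Embedding it in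
  $\mathbb{R}^d$ also covers \<open>k = 0\<close>, for which there is no type \<^typ>\<open>real ^ 'k\<close>.\<close>

definition unit_cube :: "nat \<Rightarrow> (real ^ 'n::{finite,wellorder}) set" where
  "unit_cube k = {x. \<forall>i. if coord_pos i < k then 0 \<le> x $ i \<and> x $ i \<le> 1 else x $ i = 0}"


subsection \<open>Normalized volume\<close>

definition lattice_basis :: "'a::euclidean_space set \<Rightarrow> 'a set \<Rightarrow> bool" where
  "lattice_basis B L \<longleftrightarrow> finite B \<and> independent B \<and>
     L = range (\<lambda>c :: 'a \<Rightarrow> int. \<Sum>b\<in>B. of_int (c b) *\<^sub>R b)"

text \<open>
  For \<open>P\<close> contained in a translate of the real span of the lattice \<open>L\<close>: Lebesgue measure of \<open>P\<close> in
  the coordinates given by a lattice basis \<open>B\<close> and an origin \<open>p \<in> P\<close>, times \<open>r!\<close> for \<open>r = card B\<close>.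
  A unimodular simplex is the standard simplex, of Lebesgue measure \<open>1/r!\<close>, in suitable such
  coordinates, so it gets volume \<open>1\<close>. Two bases of \<open>L\<close> differ by a unimodular integer matrix, so the
  choices do not affect the value. For \<open>r = 0\<close> a point has volume \<open>1\<close>.
\<close>

definition normalized_volume :: "'a::euclidean_space set \<Rightarrow> 'a set \<Rightarrow> real" where
  "normalized_volume L P =
     (let B = (SOME B. lattice_basis B L); p = (SOME p. p \<in> P)
      in fact (card B) *
         measure (\<Pi>\<^sub>M b\<in>B. lborel) {c \<in> B \<rightarrow>\<^sub>E UNIV. p + (\<Sum>b\<in>B. c b *\<^sub>R b) \<in> P})"

definition integer_points :: "(real ^ 'n) set" where
  "integer_points = {z. \<forall>i. z $ i \<in> \<int>}"

definition difference_lattice :: "(real ^ 'n) set" where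
  "difference_lattice = {z \<in> integer_points. (\<Sum>i\<in>UNIV. z $ i) = 0}"


subsection \<open>Lattice equivalence and the chain-poset permutahedron\<close>

definition affine_map_on :: "'a::real_vector set \<Rightarrow> ('a \<Rightarrow> 'b::real_vector) \<Rightarrow> bool" where
  "affine_map_on S f \<longleftrightarrow>
     (\<forall>x\<in>S. \<forall>y\<in>S. \<forall>t. f ((1 - t) *\<^sub>R x + t *\<^sub>R y) = (1 - t) *\<^sub>R f x + t *\<^sub>R f y)"

definition lattice_equivalent :: "(real ^ 'n) set \<Rightarrow> (real ^ 'm) set \<Rightarrow> bool" where
  "lattice_equivalent P Q \<longleftrightarrow>
     (\<exists>f. affine_map_on (affine hull P) f \<and>
          bij_betw f (affine hull P) (affine hull Q) \<and>
          bij_betw f (affine hull P \<inter> integer_points) (affine hull Q \<inter> integer_points) \<and>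
          f ` P = Q)"

text \<open>The poset permutahedron of the chain $1 < \cdots < d$, translated by \<open>-(1,\<dots>,1)\<close>.\<close>

definition translated_chain_permutahedron :: "(real ^ 'n::{finite,wellorder}) set" where
  "translated_chain_permutahedron =
     {a. (\<forall>i j. i \<le> j \<longrightarrow> a $ i \<le> a $ j) \<and>
         (\<Sum>i\<in>UNIV. a $ i) = real (CARD('n) choose 2) \<and>
         (\<forall>k. 1 \<le> k \<and> k < CARD('n) \<longrightarrow>
            (\<Sum>i | coord_pos i < k. a $ i) \<ge> real (k choose 2))}"

end

theory Submission
  imports Defs
begin

text \<open>
  A permutation avoids 132 and 213 iff it is cut into blocks of consecutive increasing values, the
  blocks descending. Put \<open>f\<^sub>k(x) = d + (d-1) + \<dots> + (d-k+1) - (x\<^sub>1 + \<dots> + x\<^sub>k)\<close> and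
  \<open>g\<^sub>k(x) = 1 + x\<^sub>k - x\<^sub>k\<^sub>+\<^sub>1\<close> for \<open>1 \<le> k < d\<close>. Then \<open>g\<^sub>k = 2 - (2 f\<^sub>k - f\<^sub>k\<^sub>-\<^sub>1 - f\<^sub>k\<^sub>+\<^sub>1)\<close>, so on the
  polytope \<open>f \<ge> 0, g \<ge> 0\<close> the two inequalities with index \<open>k\<close> are never tight together, while every
  choice of one inequality from each pair is tight at the permutation whose blocks end where \<open>f\<close> was
  chosen. Such a polytope has the face lattice of a cube and is the hull of these vertices; hence it
  is the avoidance polytope. The map \<open>x \<mapsto> (d + i - 1 - x\<^sub>i)\<^sub>i\<close> turns its inequalities into those of
  twice the translated chain permutahedron.

  The functions \<open>y\<^sub>k = f\<^sub>k(x)\<close> are lattice coordinates, in which the polytope is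
  \<open>D\<^sub>d = {y \<ge> 0, 2 y\<^sub>k - y\<^sub>k\<^sub>-\<^sub>1 - y\<^sub>k\<^sub>+\<^sub>1 \<le> 2}\<close> with \<open>y\<^sub>0 = y\<^sub>d = 0\<close>. It is the union of the cones from the
  vertex \<open>y\<^sub>k = k (d - k)\<close> over the facets \<open>y\<^sub>k = 0\<close>, and such a facet is \<open>D\<^sub>k \<times> D\<^sub>d\<^sub>-\<^sub>k\<close>. This gives a
  recurrence for the volume, which Abel's binomial identity solves.
\<close>

section \<open>Abel's binomial identity\<close>

text \<open>The vertex y_k = k (d - k) lies on every second-difference facet and on no facet y_k =
  0, which is why the cones over the latter alone fill D_d. On y_k = 0 the second-difference
  inequality at k becomes 0 \<le> 2 + y_(k-1) + y_(k+1), which is automatic, and no other inequality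
  links the two sides of k: this is the product structure. The cone is a pyramid of height k (d - k)
  in dimension d - 1, so the volumes satisfy V_d = sum of k (d - k) / (d - 1) V_k V_(d-k). Cells are
  attached to intervals of indices rather than to lengths, so that both factors of a facet are cells
  again without renumbering.

  \<open>normalized_volume\<close> picks an unspecified lattice basis and origin. Two choices are
  not compared with each other; each is compared with one body in the full space that mentions
  neither. There the lattice basis is completed to a square integer matrix, so that a determinant is
  available although the lattice only has rank d - 1.\<close>

text \<open>An N-th finite difference kills polynomials of degree below N: Pascal's rule turns the
  sum for N + 1 into the sum for N of first differences, and taking a first difference lowers the
  degree.\<close>

lemma alternating_binomial_power_sum_eq_0:
  fixes x :: real
  assumes "i < N"
  shows "(\<Sum>k\<le>N. (-1) ^ k * real (N choose k) * (x + real k) ^ i) = 0"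
  using assms
proof (induction N arbitrary: i x)
  case 0
  then show ?case by simp
next
  case (Suc N)
  have pascal: "(\<Sum>k\<le>Suc N. (-1) ^ k * real (Suc N choose k) * f k)
      = (\<Sum>k\<le>N. (-1) ^ k * real (N choose k) * (f k - f (Suc k)))" for f :: "nat \<Rightarrow> real"
  proof -
    have "(\<Sum>k\<le>Suc N. (-1) ^ k * real (Suc N choose k) * f k)
        = f 0 + (\<Sum>k\<le>N. (-1) ^ Suc k * real (Suc N choose Suc k) * f (Suc k))"
      by (subst sum.atMost_Suc_shift) simp
    also have "(\<Sum>k\<le>N. (-1) ^ Suc k * real (Suc N choose Suc k) * f (Suc k))
        = (\<Sum>k\<le>N. (-1) ^ Suc k * real (N choose Suc k) * f (Suc k))
        - (\<Sum>k\<le>N. (-1) ^ k * real (N choose k) * f (Suc k))"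
      unfolding sum_subtractf[symmetric]
      by (intro sum.cong refl) (simp add: algebra_simps)
    also have "f 0 + ((\<Sum>k\<le>N. (-1) ^ Suc k * real (N choose Suc k) * f (Suc k))
        - (\<Sum>k\<le>N. (-1) ^ k * real (N choose k) * f (Suc k)))
        = (\<Sum>k\<le>Suc N. (-1) ^ k * real (N choose k) * f k)
        - (\<Sum>k\<le>N. (-1) ^ k * real (N choose k) * f (Suc k))"
      by (subst sum.atMost_Suc_shift) simp
    also have "\<dots> = (\<Sum>k\<le>N. (-1) ^ k * real (N choose k) * (f k - f (Suc k)))"
      by (simp add: sum_subtractf algebra_simps)
    finally show ?thesis .
  qed
  have diff: "(x + real k) ^ i - (x + real (Suc k)) ^ i
      = - (\<Sum>j<i. real (i choose j) * (x + real k) ^ j)" for k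
  proof -
    have "(x + real (Suc k)) ^ i = ((x + real k) + 1) ^ i" by (simp add: algebra_simps)
    also have "\<dots> = (\<Sum>j\<le>i. real (i choose j) * (x + real k) ^ j)"
      by (subst binomial_ring) simp
    also have "\<dots> = (\<Sum>j<i. real (i choose j) * (x + real k) ^ j) + (x + real k) ^ i"
      by (simp add: lessThan_Suc_atMost[symmetric])
    finally show ?thesis by simp
  qed
  have "(\<Sum>k\<le>Suc N. (-1) ^ k * real (Suc N choose k) * (x + real k) ^ i)
      = (\<Sum>k\<le>N. \<Sum>j<i. - real (i choose j) * ((-1) ^ k * real (N choose k) * (x + real k) ^ j))"
    unfolding pascal diff by (simp add: sum_distrib_left sum_negf mult_ac)
  also have "\<dots> = (\<Sum>j<i. - real (i choose j) *
      (\<Sum>k\<le>N. (-1) ^ k * real (N choose k) * (x + real k) ^ j))"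
    by (subst sum.swap) (simp add: sum_distrib_left)
  also have "\<dots> = 0"
    using Suc by (intro sum.neutral) auto
  finally show ?case .
qed

text \<open>This is the coefficient of x in Abel's identity for (x + y)^n. After expansion in powers
  of y, the coefficient of y^j is a multiple of the alternating binomial sum of k^(N-1) with N = n -
  j, which vanishes unless N = 1.\<close>

lemma Abel_binomial_identity:
  fixes y :: real
  shows "(\<Sum>k=1..n. real (n choose k) * real k ^ (k - 1) * (y - real k) ^ (n - k)) = real n * y ^ (n - 1)"
proof (cases "n = 0")
  case False
  define g where "g j k = real (n choose k) * real k ^ (k - 1)
    * (real (n - k choose j) * y ^ j * (- real k) ^ (n - k - j))" for j k
  have "(\<Sum>k=1..n. real (n choose k) * real k ^ (k - 1) * (y - real k) ^ (n - k))
      = (\<Sum>k=1..n. \<Sum>j\<le>n - k. g j k)"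
  proof (intro sum.cong refl)
    fix k
    have "(y - real k) ^ (n - k) = (y + - real k) ^ (n - k)" by simp
    also have "\<dots> = (\<Sum>j\<le>n - k. real (n - k choose j) * y ^ j * (- real k) ^ (n - k - j))"
      by (rule binomial_ring)
    finally show "real (n choose k) * real k ^ (k - 1) * (y - real k) ^ (n - k) = (\<Sum>j\<le>n - k. g j k)"
      by (simp add: g_def sum_distrib_left)
  qed
  also have "\<dots> = (\<Sum>k=1..n. \<Sum>j<n. g j k)"
    by (intro sum.cong sum.mono_neutral_left) (auto simp: g_def binomial_eq_0)
  also have "\<dots> = (\<Sum>j<n. \<Sum>k=1..n. g j k)"
    by (rule sum.swap)
  also have "\<dots> = (\<Sum>j<n. if j = n - 1 then real n * y ^ (n - 1) else 0)"
  proof (intro sum.cong refl)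
    fix j assume "j \<in> {..<n}"
    define N where "N = n - j"
    have N: "N > 0" "j + N = n" using \<open>j \<in> {..<n}\<close> by (auto simp: N_def)
    have gjk: "g j k = real (n choose j) * y ^ j * (-1) ^ N * ((-1) ^ k * real (N choose k) * (0 + real k) ^ (N - 1))"
      if "k \<in> {1..N}" for k
    proof -
      have "real (n choose k) * real (n - k choose j) = real (n choose j) * real (N choose k)"
      proof -
        have "(n choose k) * (n - k choose j) = (n choose (n - k)) * (n - k choose j)"
          using that N by (subst binomial_symmetric) auto
        also have "\<dots> = (n choose j) * ((n - j) choose (n - k - j))"
          using that N by (intro choose_mult) auto
        also have "(n - j) choose (n - k - j) = N choose k"
          using that N by (subst binomial_symmetric) (auto simp: N_def)
        finally show ?thesis by (metis of_nat_mult)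
      qed
      moreover have "(- real k) ^ (n - k - j) = (-1) ^ N * (-1) ^ k * real k ^ (N - k)"
      proof -
        have "(- real k) ^ (N - k) = (-1) ^ (N - k) * real k ^ (N - k)"
          by (rule power_minus)
        also have "(-1 :: real) ^ (N - k) = (-1) ^ N * (-1) ^ k"
          using that by (auto simp: minus_one_power_iff)
        finally show ?thesis by (simp add: N_def diff_commute add.commute)
      qed
      moreover have "real k ^ (k - 1) * real k ^ (N - k) = real k ^ (N - 1)"
        using that by (simp flip: power_add)
      ultimately show ?thesis
        unfolding g_def by (simp add: mult_ac)
    qed
    have "(\<Sum>k=1..n. g j k) = (\<Sum>k=1..N. g j k)"
      using N by (intro sum.mono_neutral_right) (auto simp: g_def binomial_eq_0)
    also have "\<dots> = real (n choose j) * y ^ j * (-1) ^ N *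
        (\<Sum>k=1..N. (-1) ^ k * real (N choose k) * (0 + real k) ^ (N - 1))"
      unfolding sum_distrib_left by (rule sum.cong[OF refl gjk])
    also have "\<dots> = (if j = n - 1 then real n * y ^ (n - 1) else 0)"
    proof (cases "j = n - 1")
      case True
      then have "N = 1" "n choose j = n" using N binomial_symmetric[of "n - 1" n] by auto
      then show ?thesis using True by simp
    next
      case False
      then have "N \<ge> 2" using N by linarith
      \<comment> \<open>The added term k = 0 is 0^(N-1), which is 0 only because N \<ge> 2. For N =
        1 it would be 1, and so that coefficient survives.\<close>
      have "(\<Sum>k=1..N. (-1) ^ k * real (N choose k) * (0 + real k) ^ (N - 1))
          = (\<Sum>k\<le>N. (-1) ^ k * real (N choose k) * (0 + real k) ^ (N - 1))"
        using \<open>N \<ge> 2\<close> by (intro sum.mono_neutral_left) (auto simp: Suc_le_eq)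
      then show ?thesis
        using False alternating_binomial_power_sum_eq_0[of "N - 1" N 0] N by simp
    qed
    finally show "(\<Sum>k=1..n. g j k) = (if j = n - 1 then real n * y ^ (n - 1) else 0)" .
  qed
  also have "\<dots> = real n * y ^ (n - 1)"
    using False by simp
  finally show ?thesis .
qed simp

text \<open>Both sides count trees on m labelled vertices with one oriented edge; removing the edge
  leaves an ordered pair of rooted trees. The proof multiplies by m = k + (m - k), which yields two
  mirror-image sums, each given by Abel's identity at y = m.\<close>

lemma symmetric_Abel_sum:
  assumes "m \<ge> 2"
  shows "(\<Sum>k=1..<m. real (m choose k) * real k ^ (k - 1) * real (m - k) ^ (m - k - 1))
    = 2 * (real m - 1) * real m ^ (m - 2)"
proof -
  define h where "h k = real (m choose k) * real k ^ (k - 1) * real (m - k) ^ (m - k)" for k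
  let ?S = "\<Sum>k=1..<m. real (m choose k) * real k ^ (k - 1) * real (m - k) ^ (m - k - 1)"
  have "real m * real m ^ (m - 1) = (\<Sum>k=1..m. h k)"
    unfolding Abel_binomial_identity[symmetric] h_def by (intro sum.cong refl) (simp add: of_nat_diff)
  \<comment> \<open>The term k = m is m^(m-1), by 0^0 = 1, and has to be subtracted.\<close>
  also have "{1..m} = insert m {1..<m}" using assms by auto
  finally have h: "sum h {1..<m} = real m * real m ^ (m - 1) - real m ^ (m - 1)"
    by (simp add: h_def)
  have "real m * ?S = (\<Sum>k=1..<m. h k + h (m - k))"
    unfolding sum_distrib_left
  proof (intro sum.cong refl)
    fix k assume k: "k \<in> {1..<m}"
    have "m choose (m - k) = m choose k" using k by (subst binomial_symmetric) auto
    moreover have "real k ^ k = real k * real k ^ (k - 1)"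
      "real (m - k) ^ (m - k) = real (m - k) * real (m - k) ^ (m - k - 1)"
      using k by (subst power_eq_if, simp)+
    moreover have "real m = real k + real (m - k)" using k by simp
    moreover have "m - (m - k) = k" using k by simp
    ultimately have "h k = real (m choose k) * real k ^ (k - 1) * (real (m - k) * real (m - k) ^ (m - k - 1))"
      "h (m - k) = real (m choose k) * real (m - k) ^ (m - k - 1) * (real k * real k ^ (k - 1))"
      by (simp_all only: h_def)
    with \<open>real m = real k + real (m - k)\<close> show
      "real m * (real (m choose k) * real k ^ (k - 1) * real (m - k) ^ (m - k - 1)) = h k + h (m - k)"
      by (simp only: distrib_left distrib_right mult_ac)
  qed
  also have "\<dots> = sum h {1..<m} + (\<Sum>k=1..<m. h (m - k))" by (rule sum.distrib)
  also have "(\<Sum>k=1..<m. h (m - k)) = sum h {1..<m}"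
    by (rule sum.reindex_bij_witness[of _ "\<lambda>k. m - k" "\<lambda>k. m - k"]) auto
  finally have "real m * ?S = 2 * (real m - 1) * real m ^ (m - 1)" using h by (simp add: algebra_simps)
  also have "real m ^ (m - 1) = real m * real m ^ (m - 2)"
    using assms by (cases "m - 1") (auto simp: numeral_2_eq_2)
  finally show ?thesis using assms by simp
qed

section \<open>The volume in slack coordinates\<close>

interpretation lborel_product: product_sigma_finite "\<lambda>_. lborel :: real measure"
  by standard

text \<open>Change of variables for a homothety followed by a translation, one coordinate at a time.
  It compares a slice of a pyramid with its base.\<close>

lemma nn_integral_PiM_lborel_affine:
  fixes s :: "'i \<Rightarrow> real" and t :: real
  assumes "finite J" "t > 0" "f \<in> borel_measurable (\<Pi>\<^sub>M j\<in>J. lborel)"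
  shows "(\<integral>\<^sup>+x. f x \<partial>(\<Pi>\<^sub>M j\<in>J. lborel))
    = ennreal (t ^ card J) * (\<integral>\<^sup>+x. f (\<lambda>j\<in>J. t * x j + s j) \<partial>(\<Pi>\<^sub>M j\<in>J. lborel))"
  using assms(1,3)
proof (induction J arbitrary: f)
  case empty
  then show ?case
    by (simp add: PiM_empty nn_integral_count_space_finite)
next
  case (insert i J)
  note [measurable] = insert.prems
  define F where "F x = ennreal t * (\<integral>\<^sup>+y. f (x(i := s i + t * y)) \<partial>lborel)" for x
  have upd[measurable]: "(\<lambda>p. (fst p)(i := s i + t * snd p)) \<in>
      (\<Pi>\<^sub>M j\<in>J. lborel) \<Otimes>\<^sub>M lborel \<rightarrow>\<^sub>M (\<Pi>\<^sub>M j\<in>insert i J. lborel)"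
    by (rule measurable_fun_upd[where J = J]) auto
  have [measurable]: "(\<lambda>(x, y). f (x(i := s i + t * y))) \<in>
      borel_measurable ((\<Pi>\<^sub>M j\<in>J. lborel) \<Otimes>\<^sub>M lborel)"
    using measurable_compose[OF upd insert.prems] by (simp add: case_prod_beta)
  have F[measurable]: "F \<in> borel_measurable (\<Pi>\<^sub>M j\<in>J. lborel)"
    unfolding F_def by measurable
  have aff[measurable]: "(\<lambda>x. \<lambda>j\<in>insert i J. t * x j + s j) \<in>
      (\<Pi>\<^sub>M j\<in>insert i J. lborel) \<rightarrow>\<^sub>M (\<Pi>\<^sub>M j\<in>insert i J. lborel)"
    by measurable
  have aff': "(\<lambda>x. \<lambda>j\<in>J. t * x j + s j) \<in>
      (\<Pi>\<^sub>M j\<in>J. lborel) \<rightarrow>\<^sub>M (\<Pi>\<^sub>M j\<in>J. lborel)"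
    by measurable
  have "(\<integral>\<^sup>+x. f x \<partial>(\<Pi>\<^sub>M j\<in>insert i J. lborel))
      = (\<integral>\<^sup>+x. \<integral>\<^sup>+y. f (x(i := y)) \<partial>lborel \<partial>(\<Pi>\<^sub>M j\<in>J. lborel))"
    using insert by (intro lborel_product.product_nn_integral_insert) auto
  also have "\<dots> = (\<integral>\<^sup>+x. F x \<partial>(\<Pi>\<^sub>M j\<in>J. lborel))"
  proof (intro nn_integral_cong)
    fix x assume "x \<in> space (\<Pi>\<^sub>M j\<in>J. lborel :: real measure)"
    then have "(\<lambda>y. f (x(i := y))) \<in> borel_measurable lborel"
      using measurable_compose[OF measurable_component_update insert.prems] insert.hyps by simp
    then show "(\<integral>\<^sup>+y. f (x(i := y)) \<partial>lborel) = F x"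
      using \<open>t > 0\<close> unfolding F_def by (subst nn_integral_real_affine[where c = t and t = "s i"]) auto
  qed
  also have "\<dots> = ennreal (t ^ card J) *
      (\<integral>\<^sup>+x. F (\<lambda>j\<in>J. t * x j + s j) \<partial>(\<Pi>\<^sub>M j\<in>J. lborel))"
    by (rule insert.IH[OF F])
  also have "(\<integral>\<^sup>+x. F (\<lambda>j\<in>J. t * x j + s j) \<partial>(\<Pi>\<^sub>M j\<in>J. lborel))
      = ennreal t * (\<integral>\<^sup>+x. \<integral>\<^sup>+y. f ((\<lambda>j\<in>J. t * x j + s j)(i := s i + t * y)) \<partial>lborel
          \<partial>(\<Pi>\<^sub>M j\<in>J. lborel))"
    unfolding F_def
    by (intro nn_integral_cmult measurable_compose[OF aff', of "\<lambda>x. \<integral>\<^sup>+y. f (x(i := s i + t * y)) \<partial>lborel"]) measurable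
  also have "(\<integral>\<^sup>+x. \<integral>\<^sup>+y. f ((\<lambda>j\<in>J. t * x j + s j)(i := s i + t * y)) \<partial>lborel \<partial>(\<Pi>\<^sub>M j\<in>J. lborel))
      = (\<integral>\<^sup>+x. \<integral>\<^sup>+y. f (\<lambda>j\<in>insert i J. t * (x(i := y)) j + s j) \<partial>lborel \<partial>(\<Pi>\<^sub>M j\<in>J. lborel))"
    using insert.hyps by (intro nn_integral_cong arg_cong[where f = f]) (auto simp: fun_eq_iff)
  also have "\<dots> = (\<integral>\<^sup>+x. f (\<lambda>j\<in>insert i J. t * x j + s j) \<partial>(\<Pi>\<^sub>M j\<in>insert i J. lborel))"
    using insert.hyps
    by (intro lborel_product.product_nn_integral_insert[symmetric] measurable_compose[OF aff]) auto
  finally show ?case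
    using insert.hyps \<open>t > 0\<close> by (simp add: ennreal_mult mult_ac del: restrict_apply insert_iff)
qed

text \<open>By Fubini in the coordinate k: since \<alpha> \<noteq> 0, each line in that direction
  meets the hyperplane in at most one point. This makes the overlaps of the cones
  negligible.\<close>

lemma AE_PiM_lborel_ratio_neq:
  fixes \<alpha> \<beta> :: real
  assumes "finite I" "k \<in> I" "l \<in> I" "k \<noteq> l" "\<alpha> \<noteq> 0"
  shows "AE y in (\<Pi>\<^sub>M i\<in>I. lborel). \<alpha> * y k \<noteq> \<beta> * y l"
proof -
  let ?J = "I - {k}"
  have I: "I = insert k ?J" using assms by auto
  let ?N = "{y \<in> space (\<Pi>\<^sub>M i\<in>I. lborel :: real measure). \<alpha> * y k = \<beta> * y l}"
  have [measurable]: "?N \<in> sets (\<Pi>\<^sub>M i\<in>I. lborel)"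
    using assms by measurable
  have "emeasure (\<Pi>\<^sub>M i\<in>I. lborel) ?N = (\<integral>\<^sup>+y. indicator ?N y \<partial>(\<Pi>\<^sub>M i\<in>I. lborel))"
    by simp
  also have "\<dots> = (\<integral>\<^sup>+x. \<integral>\<^sup>+y. indicator ?N (x(k := y)) \<partial>lborel \<partial>(\<Pi>\<^sub>M i\<in>?J. lborel))"
    using lborel_product.product_nn_integral_insert[of ?J k "indicator ?N"] assms
    by (simp flip: I add: insert_absorb)
  also have "\<dots> = (\<integral>\<^sup>+x. 0 \<partial>(\<Pi>\<^sub>M i\<in>?J. lborel :: real measure))"
  proof (intro nn_integral_cong)
    fix x
    have "(\<integral>\<^sup>+y. indicator ?N (x(k := y)) \<partial>lborel) \<le> (\<integral>\<^sup>+y. indicator {\<beta> * x l / \<alpha>} y \<partial>lborel)"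
      using assms by (intro nn_integral_mono) (auto simp: indicator_def field_simps)
    then show "(\<integral>\<^sup>+y. indicator ?N (x(k := y)) \<partial>lborel) = (0 :: ennreal)"
      by simp
  qed
  finally have "emeasure (\<Pi>\<^sub>M i\<in>I. lborel) ?N = 0" by simp
  then show ?thesis
    by (intro AE_I[where N = ?N]) auto
qed

section \<open>The cells and their division into pyramids\<close>

text \<open>The boundary values 0 at a and b give the second-difference inequality the same form at
  every index strictly between them.\<close>

definition zero_ext :: "nat \<Rightarrow> nat \<Rightarrow> (nat \<Rightarrow> real) \<Rightarrow> nat \<Rightarrow> real" where
  "zero_ext a b y k = (if a < k \<and> k < b then y k else 0)"

definition cell_ineqs :: "nat \<Rightarrow> nat \<Rightarrow> (nat \<Rightarrow> real) \<Rightarrow> bool" where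
  "cell_ineqs a b z \<longleftrightarrow> (\<forall>k. a < k \<and> k < b \<longrightarrow> 0 \<le> z k \<and> 2 * z k \<le> 2 + z (k - 1) + z (k + 1))"

text \<open>The polytope D of length b - a, on the indices strictly between a and b. With intervals
  as parameters, the facet y_k = 0 is the product of \<open>dual_cell a k\<close> and
  \<open>dual_cell k b\<close> on the same indices.\<close>

definition dual_cell :: "nat \<Rightarrow> nat \<Rightarrow> (nat \<Rightarrow> real) set" where
  "dual_cell a b = {y \<in> {a<..<b} \<rightarrow>\<^sub>E UNIV. cell_ineqs a b (zero_ext a b y)}"

text \<open>The vertex at which all upper inequalities are tight.\<close>

definition apex :: "nat \<Rightarrow> nat \<Rightarrow> nat \<Rightarrow> real" where
  "apex a b k = real (k - a) * real (b - k)"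

lemma apex_second_difference:
  "a < k \<Longrightarrow> k < b \<Longrightarrow> 2 * apex a b k = 2 + apex a b (k - 1) + apex a b (k + 1)"
  by (simp add: apex_def of_nat_diff algebra_simps)

lemma apex_pos: "a < k \<Longrightarrow> k < b \<Longrightarrow> apex a b k > 0"
  by (simp add: apex_def)

text \<open>At the leftmost place of a positive maximum, which is interior, the left neighbour is
  strictly smaller and the right one not larger; this contradicts convexity.\<close>

lemma discrete_maximum_principle:
  fixes z :: "nat \<Rightarrow> real"
  assumes "z a \<le> 0" "z b \<le> 0"
    and conv: "\<And>k. a < k \<Longrightarrow> k < b \<Longrightarrow> 2 * z k \<le> z (k - 1) + z (k + 1)"
    and k: "a \<le> k" "k \<le> b"
  shows "z k \<le> 0"
proof (rule ccontr)
  assume "\<not> z k \<le> 0"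
  define M where "M = Max (z ` {a..b})"
  have "z k \<le> M" unfolding M_def using k by (intro Max_ge) auto
  have le: "z j \<le> M" if "a \<le> j" "j \<le> b" for j unfolding M_def using that by (intro Max_ge) auto
  have "M \<in> z ` {a..b}" unfolding M_def using k by (intro Max_in) auto
  then obtain j0 where "a \<le> j0" "j0 \<le> b" "z j0 = M" by auto
  define j where "j = (LEAST j. a \<le> j \<and> j \<le> b \<and> z j = M)"
  have j: "a \<le> j" "j \<le> b" "z j = M"
    using LeastI[of "\<lambda>j. a \<le> j \<and> j \<le> b \<and> z j = M" j0] \<open>a \<le> j0\<close> \<open>j0 \<le> b\<close> \<open>z j0 = M\<close>
    unfolding j_def by auto
  have "M > 0" using \<open>\<not> z k \<le> 0\<close> \<open>z k \<le> M\<close> by simp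
  then have "a < j" "j < b" using assms(1,2) j by (metis le_neq_implies_less not_le)+
  moreover have "z (j - 1) \<noteq> M"
    using not_less_Least[of "j - 1" "\<lambda>j. a \<le> j \<and> j \<le> b \<and> z j = M"] \<open>a < j\<close> \<open>j < b\<close>
    by (fold j_def) auto
  ultimately show False
    using conv[of j] le[of "j - 1"] le[of "j + 1"] j(3) by force
qed

text \<open>Subtracting the apex cancels the constant 2, since the apex satisfies the inequalities
  with equality. The difference is therefore convex and vanishes at both ends.\<close>

lemma dual_cell_le_apex:
  assumes "y \<in> dual_cell a b" "a < k" "k < b"
  shows "y k \<le> apex a b k"
proof -
  have "zero_ext a b y k - apex a b k \<le> 0"
  proof (rule discrete_maximum_principle[of _ a b])
    fix k assume "a < k" "k < b"
    then show "2 * (zero_ext a b y k - apex a b k) \<le>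
        zero_ext a b y (k - 1) - apex a b (k - 1) + (zero_ext a b y (k + 1) - apex a b (k + 1))"
      using assms(1) apex_second_difference[of a k b] by (auto simp: dual_cell_def cell_ineqs_def algebra_simps)
  qed (use assms in \<open>auto simp: zero_ext_def apex_def\<close>)
  then show ?thesis using assms by (simp add: zero_ext_def)
qed

lemma borel_measurable_zero_ext:
  "(\<lambda>y. zero_ext a b y k) \<in> borel_measurable (\<Pi>\<^sub>M i\<in>{a<..<b}. lborel)"
  unfolding zero_ext_def by (cases "a < k \<and> k < b") auto

lemma dual_cell_sets[measurable]: "dual_cell a b \<in> sets (\<Pi>\<^sub>M i\<in>{a<..<b}. lborel)"
proof -
  have "dual_cell a b = {y \<in> space (\<Pi>\<^sub>M i\<in>{a<..<b}. lborel). \<forall>k\<in>{a<..<b}.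
      0 \<le> zero_ext a b y k \<and> 2 * zero_ext a b y k \<le> 2 + zero_ext a b y (k - 1) + zero_ext a b y (k + 1)}"
    by (auto simp: dual_cell_def cell_ineqs_def space_PiM)
  also have "\<dots> \<in> sets (\<Pi>\<^sub>M i\<in>{a<..<b}. lborel)"
    by (intro sets.sets_Collect_finite_All sets.sets_Collect_conj borel_measurable_le borel_measurable_add
        borel_measurable_times borel_measurable_const borel_measurable_zero_ext) auto
  finally show ?thesis .
qed

text \<open>The cone from the apex over the facet \<open>y\<^sub>k = 0\<close>.\<close>

definition cone_piece :: "nat \<Rightarrow> nat \<Rightarrow> nat \<Rightarrow> (nat \<Rightarrow> real) set" where
  "cone_piece a b k = {y \<in> dual_cell a b. \<forall>l\<in>{a<..<b}. apex a b l * y k \<le> apex a b k * y l}"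

lemma cone_piece_sets[measurable]:
  assumes "a < k" "k < b"
  shows "cone_piece a b k \<in> sets (\<Pi>\<^sub>M i\<in>{a<..<b}. lborel)"
proof -
  have "cone_piece a b k = dual_cell a b \<inter>
      {y \<in> space (\<Pi>\<^sub>M i\<in>{a<..<b}. lborel).
        \<forall>l\<in>{a<..<b}. apex a b l * zero_ext a b y k \<le> apex a b k * zero_ext a b y l}"
    using assms by (auto simp: cone_piece_def dual_cell_def space_PiM zero_ext_def)
  moreover have "{y \<in> space (\<Pi>\<^sub>M i\<in>{a<..<b}. lborel).
        \<forall>l\<in>{a<..<b}. apex a b l * zero_ext a b y k \<le> apex a b k * zero_ext a b y l}
      \<in> sets (\<Pi>\<^sub>M i\<in>{a<..<b}. lborel)"
    by (intro sets.sets_Collect_finite_All borel_measurable_le borel_measurable_times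
        borel_measurable_const borel_measurable_zero_ext) auto
  ultimately show ?thesis by simp
qed

text \<open>The ray from the apex through y reaches first the hyperplane y_k = 0 whose ratio
  \<open>y k / apex a b k\<close> is smallest, so y lies in the cone of a minimising index.\<close>

lemma dual_cell_eq_Union_cone_pieces:
  assumes "{a<..<b} \<noteq> {}"
  shows "dual_cell a b = (\<Union>k\<in>{a<..<b}. cone_piece a b k)"
proof (intro equalityI subsetI)
  fix y assume y: "y \<in> dual_cell a b"
  define r where "r k = y k / apex a b k" for k
  obtain k where k: "k \<in> {a<..<b}" "r k = Min (r ` {a<..<b})"
    using Min_in[of "r ` {a<..<b}"] assms by (metis finite_greaterThanLessThan finite_imageI image_iff image_is_empty)
  have "apex a b l * y k \<le> apex a b k * y l" if "l \<in> {a<..<b}" for l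
  proof -
    have "r k \<le> r l" using k that by auto
    then show ?thesis
      using apex_pos[of a k b] apex_pos[of a l b] that k(1) by (simp add: r_def field_simps)
  qed
  then show "y \<in> (\<Union>k\<in>{a<..<b}. cone_piece a b k)"
    using y k(1) unfolding cone_piece_def by blast
qed (auto simp: cone_piece_def)

text \<open>Two cones meet only where the ratios of two different indices agree. Outside these
  finitely many null hyperplanes the indicator of the cell is the sum of the indicators of the
  cones.\<close>

lemma emeasure_dual_cell_eq_sum_cone_pieces:
  assumes "{a<..<b} \<noteq> {}"
  shows "emeasure (\<Pi>\<^sub>M i\<in>{a<..<b}. lborel) (dual_cell a b)
    = (\<Sum>k\<in>{a<..<b}. emeasure (\<Pi>\<^sub>M i\<in>{a<..<b}. lborel) (cone_piece a b k))"
proof -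
  let ?M = "\<Pi>\<^sub>M i\<in>{a<..<b}. lborel :: real measure"
  have "AE y in ?M. \<forall>k\<in>{a<..<b}. \<forall>l\<in>{a<..<b}. k \<noteq> l \<longrightarrow> apex a b l * y k \<noteq> apex a b k * y l"
  proof (intro AE_finite_allI ballI)
    fix k l assume "k \<in> {a<..<b}" "l \<in> {a<..<b}"
    then show "AE y in ?M. k \<noteq> l \<longrightarrow> apex a b l * y k \<noteq> apex a b k * y l"
      using AE_PiM_lborel_ratio_neq[of "{a<..<b}" k l "apex a b l" "apex a b k"] apex_pos[of a l b]
      by (cases "k = l") auto
  qed auto
  then have "AE y in ?M. indicator (dual_cell a b) y = (\<Sum>k\<in>{a<..<b}. indicator (cone_piece a b k) y :: ennreal)"
  proof (rule AE_mp, intro AE_I2 impI)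
    fix y assume ne: "\<forall>k\<in>{a<..<b}. \<forall>l\<in>{a<..<b}. k \<noteq> l \<longrightarrow> apex a b l * y k \<noteq> apex a b k * y l"
    have uniq: "k = l" if "k \<in> {a<..<b}" "l \<in> {a<..<b}" "y \<in> cone_piece a b k" "y \<in> cone_piece a b l" for k l
      using ne that unfolding cone_piece_def by (smt (verit) mem_Collect_eq)
    show "indicator (dual_cell a b) y = (\<Sum>k\<in>{a<..<b}. indicator (cone_piece a b k) y :: ennreal)"
    proof (cases "y \<in> dual_cell a b")
      case True
      then obtain k where k: "k \<in> {a<..<b}" "y \<in> cone_piece a b k"
        using dual_cell_eq_Union_cone_pieces[OF assms] by auto
      have "(\<Sum>l\<in>{a<..<b}. indicator (cone_piece a b l) y :: ennreal) = (\<Sum>l\<in>{a<..<b}. if l = k then 1 else 0)"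
        using uniq k by (intro sum.cong refl) (auto simp: indicator_def)
      then show ?thesis using k True by simp
    next
      case False
      then show ?thesis by (auto simp: cone_piece_def)
    qed
  qed
  then have "(\<integral>\<^sup>+y. indicator (dual_cell a b) y \<partial>?M)
      = (\<integral>\<^sup>+y. (\<Sum>k\<in>{a<..<b}. indicator (cone_piece a b k) y) \<partial>?M)"
    by (rule nn_integral_cong_AE)
  also have "\<dots> = (\<Sum>k\<in>{a<..<b}. \<integral>\<^sup>+y. indicator (cone_piece a b k) y \<partial>?M)"
    by (rule nn_integral_sum) auto
  also have "\<dots> = (\<Sum>k\<in>{a<..<b}. emeasure ?M (cone_piece a b k))"
    by (intro sum.cong refl nn_integral_indicator cone_piece_sets) auto
  finally show ?thesis by simp
qed

section \<open>Slices of a pyramid and its volume\<close>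

lemma cell_ineqs_cong:
  "(\<And>i. a \<le> i \<Longrightarrow> i \<le> b \<Longrightarrow> z i = z' i) \<Longrightarrow> cell_ineqs a b z \<longleftrightarrow> cell_ineqs a b z'"
  unfolding cell_ineqs_def by (intro all_cong) auto

text \<open>The inequality at k holds by nonnegativity of the neighbours of k. All others involve
  only indices on one side of k and the value z k = 0 itself, which serves as the new boundary
  value.\<close>

lemma cell_ineqs_split:
  assumes "a < k" "k < b" "z a = 0" "z k = 0" "z b = 0"
  shows "cell_ineqs a b z \<longleftrightarrow> cell_ineqs a k z \<and> cell_ineqs k b z"
proof (intro iffI conjI)
  assume *: "cell_ineqs a k z \<and> cell_ineqs k b z"
  have "z i \<ge> 0" if "a \<le> i" "i \<le> b" for i
    using * assms that unfolding cell_ineqs_def by (metis le_neq_implies_less nat_neq_iff order_refl)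
  then have "0 \<le> z (k - 1)" "0 \<le> z (k + 1)" using assms by auto
  with * assms show "cell_ineqs a b z"
    unfolding cell_ineqs_def by (metis add_nonneg_nonneg mult_zero_right nat_neq_iff order_refl zero_le_numeral)
qed (use assms in \<open>auto simp: cell_ineqs_def\<close>)

text \<open>A homothety centred at the apex multiplies the slack of each second-difference
  inequality by t, because that slack is 0 at the centre. The lower inequalities are not scaled in
  this way, hence the separate condition on q.\<close>

lemma cell_ineqs_affine_apex:
  assumes "0 < t" "t \<le> 1"
  shows "cell_ineqs a b (\<lambda>i. t * q i + (1 - t) * apex a b i) \<and> (\<forall>i. a < i \<and> i < b \<longrightarrow> 0 \<le> q i)
    \<longleftrightarrow> cell_ineqs a b q"
proof -
  have "(2 * (t * q i + (1 - t) * apex a b i)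
      \<le> 2 + (t * q (i - 1) + (1 - t) * apex a b (i - 1)) + (t * q (i + 1) + (1 - t) * apex a b (i + 1)))
      \<longleftrightarrow> 2 * q i \<le> 2 + q (i - 1) + q (i + 1)" if "a < i" "i < b" for i
  proof -
    have "2 * (t * q i + (1 - t) * apex a b i)
        - (2 + (t * q (i - 1) + (1 - t) * apex a b (i - 1)) + (t * q (i + 1) + (1 - t) * apex a b (i + 1)))
        = t * (2 * q i - (2 + q (i - 1) + q (i + 1)))
          + (1 - t) * (2 * apex a b i - (2 + apex a b (i - 1) + apex a b (i + 1)))"
      by (simp add: algebra_simps)
    also have "\<dots> = t * (2 * q i - (2 + q (i - 1) + q (i + 1)))"
      using apex_second_difference[OF that] by simp
    finally show ?thesis
      using \<open>0 < t\<close> by (smt (verit) mult_pos_pos mult_nonneg_nonneg mult_minus_right)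
  qed
  moreover have "0 \<le> t * q i + (1 - t) * apex a b i" if "a < i" "i < b" "0 \<le> q i" for i
    using that assms apex_pos[of a i b] by simp
  ultimately show ?thesis unfolding cell_ineqs_def by blast
qed

text \<open>The slice of the cone at height (1 - t) \<open>apex a b k\<close> is the facet y_k = 0
  shrunk by t towards the apex, and the facet is a product of two cells.\<close>

lemma cone_piece_slice:
  assumes "a < k" "k < b" "0 < t" "t \<le> 1"
  shows "(\<lambda>j\<in>{a<..<b} - {k}. t * q j + (1 - t) * apex a b j)(k := (1 - t) * apex a b k) \<in> cone_piece a b k
    \<longleftrightarrow> restrict q {a<..<k} \<in> dual_cell a k \<and> restrict q {k<..<b} \<in> dual_cell k b"
proof -
  define y where "y = (\<lambda>j\<in>{a<..<b} - {k}. t * q j + (1 - t) * apex a b j)(k := (1 - t) * apex a b k)"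
  \<comment> \<open>\<open>q'\<close> is the point of the facet that is shrunk: its coordinate k is
    0, as are its boundary values. The ratio condition of the cone for index l turns into 0 \<le>
    \<open>q' l\<close>.\<close>
  define q' where "q' = zero_ext a b (q(k := 0))"
  have y: "y i = t * q' i + (1 - t) * apex a b i" if "a < i" "i < b" for i
    using that by (auto simp: y_def q'_def zero_ext_def)
  have ends: "apex a b a = 0" "apex a b b = 0" "q' a = 0" "q' b = 0" "q' k = 0"
    by (auto simp: apex_def q'_def zero_ext_def)
  have "y \<in> {a<..<b} \<rightarrow>\<^sub>E UNIV" using assms by (auto simp: y_def PiE_def extensional_def)
  then have "y \<in> dual_cell a b \<longleftrightarrow> cell_ineqs a b (zero_ext a b y)" by (simp add: dual_cell_def)
  also have "\<dots> \<longleftrightarrow> cell_ineqs a b (\<lambda>i. t * q' i + (1 - t) * apex a b i)"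
  proof (rule cell_ineqs_cong)
    fix i assume "a \<le> i" "i \<le> b"
    then consider "i = a" | "i = b" | "a < i" "i < b" by linarith
    then show "zero_ext a b y i = t * q' i + (1 - t) * apex a b i"
      by cases (auto simp: zero_ext_def ends y)
  qed
  finally have cell: "y \<in> dual_cell a b \<longleftrightarrow> cell_ineqs a b (\<lambda>i. t * q' i + (1 - t) * apex a b i)" .
  have ratio: "apex a b l * y k \<le> apex a b k * y l \<longleftrightarrow> 0 \<le> q' l" if "a < l" "l < b" for l
  proof -
    have "apex a b k * y l - apex a b l * y k = (apex a b k * t) * q' l"
      using that assms by (simp add: y ends algebra_simps)
    moreover have "apex a b k * t > 0" using assms by (simp add: apex_pos)
    ultimately show ?thesis by (smt (verit) mult_nonneg_nonneg mult_pos_neg)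
  qed
  have "y \<in> cone_piece a b k \<longleftrightarrow>
      cell_ineqs a b (\<lambda>i. t * q' i + (1 - t) * apex a b i) \<and> (\<forall>i. a < i \<and> i < b \<longrightarrow> 0 \<le> q' i)"
    unfolding cone_piece_def using cell ratio by auto
  also have "\<dots> \<longleftrightarrow> cell_ineqs a b q'" by (rule cell_ineqs_affine_apex[OF assms(3,4)])
  also have "\<dots> \<longleftrightarrow> cell_ineqs a k q' \<and> cell_ineqs k b q'" by (rule cell_ineqs_split[OF assms(1,2) ends(3,5,4)])
  also have "cell_ineqs a k q' \<longleftrightarrow> cell_ineqs a k (zero_ext a k (restrict q {a<..<k}))"
    using assms by (intro cell_ineqs_cong) (auto simp: q'_def zero_ext_def)
  also have "cell_ineqs k b q' \<longleftrightarrow> cell_ineqs k b (zero_ext k b (restrict q {k<..<b}))"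
    using assms by (intro cell_ineqs_cong) (auto simp: q'_def zero_ext_def)
  finally show ?thesis unfolding y_def[symmetric] by (simp add: dual_cell_def del: restrict_apply)
qed

text \<open>The factor height / dimension in the volume of a pyramid of height c over a base of
  dimension n.\<close>

lemma nn_integral_one_minus_power:
  fixes c :: real
  assumes "c > 0"
  shows "(\<integral>\<^sup>+s. ennreal ((1 - s / c) ^ n) * indicator {0..c} s \<partial>lborel) = ennreal (c / real (Suc n))"
proof -
  have "(\<integral>\<^sup>+s. ennreal ((1 - s / c) ^ n) * indicator {0..c} s \<partial>lborel)
      = ennreal (- (c / real (Suc n)) * (1 - c / c) ^ Suc n - - (c / real (Suc n)) * (1 - 0 / c) ^ Suc n)"
  proof (rule nn_integral_FTC_Icc[where F = "\<lambda>s. - (c / real (Suc n)) * (1 - s / c) ^ Suc n"])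
    fix s assume "s \<in> {0..c}"
    show "((\<lambda>s. - (c / real (Suc n)) * (1 - s / c) ^ Suc n) has_real_derivative (1 - s / c) ^ n) (at s)"
    proof -
      have "((\<lambda>s. 1 - s / c) has_real_derivative - (1 / c)) (at s)"
        using assms by (auto intro!: derivative_eq_intros)
      from DERIV_cmult[OF DERIV_power[OF this, of "Suc n"], of "- (c / real (Suc n))"] show ?thesis
        using assms by (simp del: of_nat_Suc power_Suc)
    qed
  qed (use assms in \<open>auto simp: field_simps\<close>)
  then show ?thesis using assms by simp
qed

lemma emeasure_cone_piece:
  assumes "a < k" "k < b"
  shows "emeasure (\<Pi>\<^sub>M i\<in>{a<..<b}. lborel) (cone_piece a b k)
    = ennreal (apex a b k / real (b - a - 1)) * (emeasure (\<Pi>\<^sub>M i\<in>{a<..<k}. lborel) (dual_cell a k)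
        * emeasure (\<Pi>\<^sub>M i\<in>{k<..<b}. lborel) (dual_cell k b))"
proof -
  let ?J = "{a<..<b} - {k}" and ?c = "apex a b k"
  let ?V = "emeasure (\<Pi>\<^sub>M i\<in>{a<..<k}. lborel) (dual_cell a k)
        * emeasure (\<Pi>\<^sub>M i\<in>{k<..<b}. lborel) (dual_cell k b)"
  have I: "insert k ?J = {a<..<b}" and J: "{a<..<k} \<union> {k<..<b} = ?J" using assms by auto
  have c: "?c > 0" using assms by (simp add: apex_pos)
  have cJ: "Suc (card ?J) = b - a - 1" using assms by simp
  note [measurable] = cone_piece_sets[OF assms]
  define f :: "(nat \<Rightarrow> real) \<Rightarrow> ennreal" where "f = indicator (cone_piece a b k)"
  have f: "f \<in> borel_measurable (\<Pi>\<^sub>M i\<in>insert k ?J. lborel)"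
    unfolding f_def I by measurable
  define g :: "(nat \<Rightarrow> real) \<Rightarrow> ennreal" where
    "g q = indicator (dual_cell a k) (restrict q {a<..<k}) * indicator (dual_cell k b) (restrict q {k<..<b})" for q
  have g: "g \<in> borel_measurable (\<Pi>\<^sub>M i\<in>{a<..<k} \<union> {k<..<b}. lborel)"
    unfolding g_def by measurable
  have g_int: "(\<integral>\<^sup>+q. g q \<partial>(\<Pi>\<^sub>M i\<in>?J. lborel)) = ?V"
  proof -
    have "(\<integral>\<^sup>+q. g q \<partial>(\<Pi>\<^sub>M i\<in>?J. lborel))
        = (\<integral>\<^sup>+x. \<integral>\<^sup>+y. g (merge {a<..<k} {k<..<b} (x, y)) \<partial>(\<Pi>\<^sub>M i\<in>{k<..<b}. lborel) \<partial>(\<Pi>\<^sub>M i\<in>{a<..<k}. lborel))"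
      using lborel_product.product_nn_integral_fold[OF _ _ _ g] by (simp add: J)
    also have "\<dots> = (\<integral>\<^sup>+x. \<integral>\<^sup>+y. indicator (dual_cell a k) x * indicator (dual_cell k b) y
        \<partial>(\<Pi>\<^sub>M i\<in>{k<..<b}. lborel) \<partial>(\<Pi>\<^sub>M i\<in>{a<..<k}. lborel))"
    proof (intro nn_integral_cong)
      fix x y assume "x \<in> space (\<Pi>\<^sub>M i\<in>{a<..<k}. lborel :: real measure)"
        "y \<in> space (\<Pi>\<^sub>M i\<in>{k<..<b}. lborel :: real measure)"
      then have "restrict (merge {a<..<k} {k<..<b} (x, y)) {a<..<k} = x"
        "restrict (merge {a<..<k} {k<..<b} (x, y)) {k<..<b} = y"
        by (auto simp: space_PiM merge_def PiE_def extensional_def fun_eq_iff)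
      then show "g (merge {a<..<k} {k<..<b} (x, y)) = indicator (dual_cell a k) x * indicator (dual_cell k b) y"
        by (simp add: g_def)
    qed
    also have "\<dots> = ?V" by (simp add: nn_integral_cmult nn_integral_multc)
    finally show ?thesis .
  qed
  \<comment> \<open>At height s the base is shrunk by 1 - s / c. The apex level s = c, where the
    scale would be 0, is left out; it is a single point and does not affect the integral over
    s.\<close>
  have slice: "(\<integral>\<^sup>+x. f (x(k := s)) \<partial>(\<Pi>\<^sub>M i\<in>?J. lborel))
      = ennreal ((1 - s / ?c) ^ card ?J) * indicator {0..?c} s * ?V" if "s \<noteq> ?c" for s
  proof (cases "0 \<le> s \<and> s < ?c")
    case False
    then have "s \<notin> {0..?c}" using that by auto
    moreover have "f (x(k := s)) = 0" for x
    proof -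
      have "x(k := s) \<notin> dual_cell a b"
      proof
        assume *: "x(k := s) \<in> dual_cell a b"
        then have "zero_ext a b (x(k := s)) k \<ge> 0" using assms by (auto simp: dual_cell_def cell_ineqs_def)
        moreover have "(x(k := s)) k \<le> ?c" using dual_cell_le_apex[OF * assms] .
        ultimately show False using False that assms by (auto simp: zero_ext_def)
      qed
      then show ?thesis by (simp add: f_def cone_piece_def)
    qed
    ultimately show ?thesis by simp
  next
    case True
    define t where "t = 1 - s / ?c"
    have t: "0 < t" "t \<le> 1" "s = (1 - t) * ?c" using True c by (auto simp: t_def)
    have "(\<lambda>x. f (x(k := s))) \<in> borel_measurable (\<Pi>\<^sub>M i\<in>?J. lborel)"
    proof -
      have "(\<lambda>x. x(k := s)) \<in> (\<Pi>\<^sub>M i\<in>?J. lborel) \<rightarrow>\<^sub>M (\<Pi>\<^sub>M i\<in>insert k ?J. lborel)"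
        by (rule measurable_fun_upd[where J = ?J]) auto
      from measurable_compose[OF this f] show ?thesis .
    qed
    then have "(\<integral>\<^sup>+x. f (x(k := s)) \<partial>(\<Pi>\<^sub>M i\<in>?J. lborel)) = ennreal (t ^ card ?J) *
        (\<integral>\<^sup>+q. f ((\<lambda>j\<in>?J. t * q j + (1 - t) * apex a b j)(k := s)) \<partial>(\<Pi>\<^sub>M i\<in>?J. lborel))"
      using t by (intro nn_integral_PiM_lborel_affine) auto
    also have "(\<integral>\<^sup>+q. f ((\<lambda>j\<in>?J. t * q j + (1 - t) * apex a b j)(k := s)) \<partial>(\<Pi>\<^sub>M i\<in>?J. lborel))
        = (\<integral>\<^sup>+q. g q \<partial>(\<Pi>\<^sub>M i\<in>?J. lborel))"
      unfolding t(3) using cone_piece_slice[OF assms t(1,2)]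
      by (intro nn_integral_cong) (auto simp: f_def g_def indicator_def)
    finally show ?thesis using True unfolding g_int by (simp add: t_def del: fun_upd_apply)
  qed
  have "emeasure (\<Pi>\<^sub>M i\<in>{a<..<b}. lborel) (cone_piece a b k) = (\<integral>\<^sup>+y. f y \<partial>(\<Pi>\<^sub>M i\<in>insert k ?J. lborel))"
    unfolding I f_def by simp
  also have "\<dots> = (\<integral>\<^sup>+s. \<integral>\<^sup>+x. f (x(k := s)) \<partial>(\<Pi>\<^sub>M i\<in>?J. lborel) \<partial>lborel)"
    using f by (intro lborel_product.product_nn_integral_insert_rev) auto
  also have "\<dots> = (\<integral>\<^sup>+s. ennreal ((1 - s / ?c) ^ card ?J) * indicator {0..?c} s * ?V \<partial>lborel)"
    using AE_lborel_singleton[of ?c] slice by (intro nn_integral_cong_AE) (auto elim!: AE_mp)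
  also have "\<dots> = (\<integral>\<^sup>+s. ennreal ((1 - s / ?c) ^ card ?J) * indicator {0..?c} s \<partial>lborel) * ?V"
    by (intro nn_integral_multc) measurable
  finally show ?thesis unfolding nn_integral_one_minus_power[OF c] cJ .
qed

section \<open>Solution of the volume recurrence\<close>

text \<open>Equals 2^(m-1) m^(m-2) / m! for m \<ge> 1. Multiplied by m it contains m^(m-1), the
  factor of the Abel sum; the recurrence supplies this multiplication through k (m - k).\<close>

definition cell_volume :: "nat \<Rightarrow> real" where
  "cell_volume m = 2 ^ (m - 1) * real m ^ (m - 1) / (real m * fact m)"

text \<open>Apart from the constant 2^(m-2) / ((m - 1) m!), the summands are those of
  \<open>symmetric_Abel_sum\<close>.\<close>

lemma cell_volume_recurrence:
  assumes "m \<ge> 2"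
  shows "(\<Sum>k=1..<m. real k * real (m - k) / real (m - 1) * (cell_volume k * cell_volume (m - k))) = cell_volume m"
proof -
  have "(\<Sum>k=1..<m. real k * real (m - k) / real (m - 1) * (cell_volume k * cell_volume (m - k)))
      = (\<Sum>k=1..<m. 2 ^ (m - 2) / (real (m - 1) * fact m) *
          (real (m choose k) * real k ^ (k - 1) * real (m - k) ^ (m - k - 1)))"
  proof (intro sum.cong refl)
    fix k assume k: "k \<in> {1..<m}"
    have "real (m choose k) = fact m / (fact k * fact (m - k))"
      using k by (intro binomial_fact) auto
    moreover have "(2::real) ^ (m - 2) = 2 ^ (k - 1) * 2 ^ (m - k - 1)"
      using k by (subst power_add[symmetric]) (auto intro!: arg_cong[where f = "power 2"])
    ultimately show "real k * real (m - k) / real (m - 1) * (cell_volume k * cell_volume (m - k))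
        = 2 ^ (m - 2) / (real (m - 1) * fact m) *
          (real (m choose k) * real k ^ (k - 1) * real (m - k) ^ (m - k - 1))"
      using k assms by (simp add: cell_volume_def divide_simps del: of_nat_diff)
  qed
  also have "\<dots> = 2 ^ (m - 2) / (real (m - 1) * fact m) * (2 * (real m - 1) * real m ^ (m - 2))"
    by (simp only: symmetric_Abel_sum[OF assms] flip: sum_distrib_left)
  also have "\<dots> = cell_volume m"
  proof -
    obtain q where "m = Suc (Suc q)" using assms by (metis Suc_le_D numeral_2_eq_2 Suc_le_mono)
    then show ?thesis by (simp add: cell_volume_def divide_simps)
  qed
  finally show ?thesis .
qed

theorem emeasure_dual_cell:
  assumes "a < b"
  shows "emeasure (\<Pi>\<^sub>M i\<in>{a<..<b}. lborel) (dual_cell a b) = ennreal (cell_volume (b - a))"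
  using assms
proof (induction "b - a" arbitrary: a b rule: less_induct)
  case less
  show ?case
  proof (cases "b - a = 1")
    case True
    then have "{a<..<b} = {}" by auto
    \<comment> \<open>Without coordinates there is just one extensional function, and the empty
      product measure gives it mass 1.\<close>
    moreover have "dual_cell a b = {\<lambda>_. undefined}"
      using True unfolding dual_cell_def \<open>{a<..<b} = {}\<close> by (auto simp: cell_ineqs_def)
    ultimately show ?thesis using True by (simp add: PiM_empty cell_volume_def)
  next
    case False
    then have m: "b - a \<ge> 2" using less.prems by simp
    then have "Suc a \<in> {a<..<b}" by simp
    then have ne: "{a<..<b} \<noteq> {}" by blast
    have nonneg: "cell_volume m \<ge> 0" for m by (simp add: cell_volume_def)
    have "emeasure (\<Pi>\<^sub>M i\<in>{a<..<b}. lborel) (dual_cell a b)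
        = (\<Sum>k\<in>{a<..<b}. ennreal (real (k - a) * real (b - k) / real (b - a - 1) * (cell_volume (k - a) * cell_volume (b - k))))"
      unfolding emeasure_dual_cell_eq_sum_cone_pieces[OF ne]
    proof (intro sum.cong refl)
      fix k assume k: "k \<in> {a<..<b}"
      then show "emeasure (\<Pi>\<^sub>M i\<in>{a<..<b}. lborel) (cone_piece a b k)
          = ennreal (real (k - a) * real (b - k) / real (b - a - 1) * (cell_volume (k - a) * cell_volume (b - k)))"
        using less.hyps[of k a] less.hyps[of b k] nonneg diff_less_mono2[of a k b]
        by (simp add: emeasure_cone_piece ennreal_mult[symmetric] apex_def diff_less_mono
            del: of_nat_diff times_divide_eq_left times_divide_eq_right)
    qed
    also have "\<dots> = ennreal (\<Sum>k\<in>{a<..<b}. real (k - a) * real (b - k) / real (b - a - 1) * (cell_volume (k - a) * cell_volume (b - k)))"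
      using nonneg by (intro sum_ennreal) auto
    also have "(\<Sum>k\<in>{a<..<b}. real (k - a) * real (b - k) / real (b - a - 1) * (cell_volume (k - a) * cell_volume (b - k)))
        = (\<Sum>k=1..<b - a. real k * real (b - a - k) / real (b - a - 1) * (cell_volume k * cell_volume (b - a - k)))"
      by (rule sum.reindex_bij_witness[of _ "\<lambda>k. k + a" "\<lambda>k. k - a"]) auto
    finally show ?thesis by (simp only: cell_volume_recurrence[OF m])
  qed
qed

section \<open>Polyhedra with the face lattice of a cube\<close>

text \<open>K indexes the pairs of opposite facets, f and g are their slacks, affine on V, and
  \<open>v S\<close> is the vertex on the f-facets with index in S and on the g-facets with the
  other indices.\<close>

locale cube_like_polyhedron =
  fixes V :: "'a::euclidean_space set" and K :: "'k set"
    and f g :: "'k \<Rightarrow> 'a \<Rightarrow> real" and v :: "'k set \<Rightarrow> 'a" and P :: "'a set"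
  assumes affine_V: "affine V" and finite_K: "finite K"
    and f_affine: "\<And>k x y t. x \<in> V \<Longrightarrow> y \<in> V \<Longrightarrow> f k ((1 - t) *\<^sub>R x + t *\<^sub>R y) = (1 - t) * f k x + t * f k y"
    and g_affine: "\<And>k x y t. x \<in> V \<Longrightarrow> y \<in> V \<Longrightarrow> g k ((1 - t) *\<^sub>R x + t *\<^sub>R y) = (1 - t) * g k x + t * g k y"
    and P_eq: "P = {x \<in> V. \<forall>k\<in>K. 0 \<le> f k x \<and> 0 \<le> g k x}"
    and opposite: "\<And>k x. k \<in> K \<Longrightarrow> x \<in> P \<Longrightarrow> f k x = 0 \<Longrightarrow> g k x \<noteq> 0"
    and v_in: "\<And>S. S \<subseteq> K \<Longrightarrow> v S \<in> P"
    and f_v: "\<And>S k. S \<subseteq> K \<Longrightarrow> k \<in> S \<Longrightarrow> f k (v S) = 0"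
    and g_v: "\<And>S k. S \<subseteq> K \<Longrightarrow> k \<in> K - S \<Longrightarrow> g k (v S) = 0"
begin

definition tight_face :: "'k set \<times> 'k set \<Rightarrow> 'a set" where
  "tight_face = (\<lambda>(S, T). {x \<in> P. (\<forall>k\<in>S. f k x = 0) \<and> (\<forall>k\<in>T. g k x = 0)})"

lemma segment_in_V: "x \<in> V \<Longrightarrow> y \<in> V \<Longrightarrow> (1 - t) *\<^sub>R x + t *\<^sub>R y \<in> V"
  using affine_V unfolding affine_alt by blast

lemma convex_P: "convex P"
  unfolding convex_alt P_eq by (auto simp: segment_in_V f_affine g_affine)

lemma P_sub_V: "P \<subseteq> V" by (auto simp: P_eq)

lemma f_nonneg: "x \<in> P \<Longrightarrow> k \<in> K \<Longrightarrow> 0 \<le> f k x" and g_nonneg: "x \<in> P \<Longrightarrow> k \<in> K \<Longrightarrow> 0 \<le> g k x"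
  by (auto simp: P_eq)

lemma convex_combination_eq_0_iff:
  fixes a b t :: real
  assumes "0 \<le> a" "0 \<le> b" "0 < t" "t < 1"
  shows "(1 - t) * a + t * b = 0 \<longleftrightarrow> a = 0 \<and> b = 0"
  using assms by (subst add_nonneg_eq_0_iff) auto

lemma tight_face_face_of:
  assumes "S \<subseteq> K" "T \<subseteq> K"
  shows "tight_face (S, T) face_of P"
  unfolding face_of_def
proof (intro conjI ballI impI)
  show "tight_face (S, T) \<subseteq> P" by (auto simp: tight_face_def)
  show "convex (tight_face (S, T))"
    unfolding convex_alt
  proof (intro ballI allI impI)
    fix x y and u :: real
    assume xy: "x \<in> tight_face (S, T)" "y \<in> tight_face (S, T)" and "0 \<le> u \<and> u \<le> 1"
    then have "(1 - u) *\<^sub>R x + u *\<^sub>R y \<in> P"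
      using convex_P unfolding convex_alt tight_face_def by auto
    then show "(1 - u) *\<^sub>R x + u *\<^sub>R y \<in> tight_face (S, T)"
      using xy P_sub_V by (auto simp: tight_face_def f_affine g_affine subset_iff)
  qed
next
  fix a b x assume "a \<in> P" "b \<in> P" "x \<in> tight_face (S, T)" "x \<in> open_segment a b"
  then obtain u where u: "0 < u" "u < 1" "x = (1 - u) *\<^sub>R a + u *\<^sub>R b"
    by (auto simp: in_segment)
  have "f k x = 0 \<Longrightarrow> f k a = 0 \<and> f k b = 0" "g k x = 0 \<Longrightarrow> g k a = 0 \<and> g k b = 0" if "k \<in> K" for k
    using convex_combination_eq_0_iff[OF f_nonneg[OF \<open>a \<in> P\<close> that] f_nonneg[OF \<open>b \<in> P\<close> that] u(1,2)]
      convex_combination_eq_0_iff[OF g_nonneg[OF \<open>a \<in> P\<close> that] g_nonneg[OF \<open>b \<in> P\<close> that] u(1,2)]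
      P_sub_V \<open>a \<in> P\<close> \<open>b \<in> P\<close> by (auto simp: u(3) f_affine g_affine subset_iff)
  then show "a \<in> tight_face (S, T)" "b \<in> tight_face (S, T)"
    using assms \<open>x \<in> tight_face (S, T)\<close> \<open>a \<in> P\<close> \<open>b \<in> P\<close> by (auto simp: tight_face_def subset_iff)
qed

lemma f_v_iff: "S \<subseteq> K \<Longrightarrow> k \<in> K \<Longrightarrow> f k (v S) = 0 \<longleftrightarrow> k \<in> S"
  using opposite v_in f_v g_v by blast

lemma g_v_iff: "S \<subseteq> K \<Longrightarrow> k \<in> K \<Longrightarrow> g k (v S) = 0 \<longleftrightarrow> k \<notin> S"
  using opposite v_in f_v g_v by blast

text \<open>The midpoint of \<open>v S\<close> and \<open>v (K - T)\<close> works. A nonnegative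
  affine slack vanishes there iff it vanishes at both ends, which happens for f on S \<inter> (K -
  T) = S and for g on (K - S) \<inter> T = T.\<close>

lemma exact_point:
  assumes "S \<subseteq> K" "T \<subseteq> K" "S \<inter> T = {}"
  obtains x where "x \<in> P" "\<And>k. k \<in> K \<Longrightarrow> f k x = 0 \<longleftrightarrow> k \<in> S" "\<And>k. k \<in> K \<Longrightarrow> g k x = 0 \<longleftrightarrow> k \<in> T"
proof
  let ?a = "v S" and ?b = "v (K - T)" and ?x = "(1 - 1/2) *\<^sub>R v S + (1/2 :: real) *\<^sub>R v (K - T)"
  have ab: "?a \<in> P" "?b \<in> P" using assms by (auto intro: v_in)
  then have V: "?a \<in> V" "?b \<in> V" using P_sub_V by auto
  show "?x \<in> P" using convex_P ab unfolding convex_alt by (smt (verit) divide_le_eq_1_pos divide_nonneg_pos)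
  show "f k ?x = 0 \<longleftrightarrow> k \<in> S" if "k \<in> K" for k
    unfolding f_affine[OF V]
    using assms that f_nonneg[OF ab(1) that] f_nonneg[OF ab(2) that]
    by (subst convex_combination_eq_0_iff) (auto simp: f_v_iff)
  show "g k ?x = 0 \<longleftrightarrow> k \<in> T" if "k \<in> K" for k
    unfolding g_affine[OF V]
    using assms that g_nonneg[OF ab(1) that] g_nonneg[OF ab(2) that]
    by (subst convex_combination_eq_0_iff) (auto simp: g_v_iff)
qed

text \<open>The index set of the nonempty faces of a cube: S lists the coordinates fixed at one end,
  T those fixed at the other.\<close>

definition signed_sets :: "('k set \<times> 'k set) set" where
  "signed_sets = {(S, T). S \<subseteq> K \<and> T \<subseteq> K \<and> S \<inter> T = {}}"

lemma tight_face_nonempty: "p \<in> signed_sets \<Longrightarrow> tight_face p \<noteq> {}"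
proof -
  assume "p \<in> signed_sets"
  then obtain S T where p: "p = (S, T)" "S \<subseteq> K" "T \<subseteq> K" "S \<inter> T = {}" by (auto simp: signed_sets_def)
  then obtain x where "x \<in> P" "\<And>k. k \<in> K \<Longrightarrow> f k x = 0 \<longleftrightarrow> k \<in> S" "\<And>k. k \<in> K \<Longrightarrow> g k x = 0 \<longleftrightarrow> k \<in> T"
    using exact_point by blast
  then have "x \<in> tight_face p" using p by (auto simp: tight_face_def)
  then show ?thesis by blast
qed

lemma tight_face_subset_iff:
  assumes "(S, T) \<in> signed_sets" "(S', T') \<in> signed_sets"
  shows "tight_face (S, T) \<subseteq> tight_face (S', T') \<longleftrightarrow> S' \<subseteq> S \<and> T' \<subseteq> T"
proof
  assume sub: "tight_face (S, T) \<subseteq> tight_face (S', T')"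
  obtain x where x: "x \<in> P" "\<And>k. k \<in> K \<Longrightarrow> f k x = 0 \<longleftrightarrow> k \<in> S" "\<And>k. k \<in> K \<Longrightarrow> g k x = 0 \<longleftrightarrow> k \<in> T"
    using exact_point assms(1) by (auto simp: signed_sets_def)
  then have "x \<in> tight_face (S, T)" using assms(1) by (auto simp: tight_face_def signed_sets_def)
  with sub have "x \<in> tight_face (S', T')" by auto
  then show "S' \<subseteq> S \<and> T' \<subseteq> T"
    using x(2,3) assms(2) unfolding tight_face_def signed_sets_def by blast
qed (auto simp: tight_face_def)

text \<open>A slack that is positive at x stays nonnegative for small e, one that is 0 at x is 0 on
  the whole line, and there are only finitely many.\<close>

lemma prolong_in_P:
  assumes "x \<in> P" "y \<in> P"
    and tight: "\<And>k. k \<in> K \<Longrightarrow> f k x = 0 \<Longrightarrow> f k y = 0" "\<And>k. k \<in> K \<Longrightarrow> g k x = 0 \<Longrightarrow> g k y = 0"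
  obtains e :: real where "e > 0" "(1 - (1 + e)) *\<^sub>R y + (1 + e) *\<^sub>R x \<in> P"
proof -
  have V: "x \<in> V" "y \<in> V" using assms P_sub_V by auto
  have small: "\<forall>\<^sub>F e in at_right 0. 0 \<le> (1 - (1 + e)) * b + (1 + e) * a"
    if "0 \<le> a" "a = 0 \<Longrightarrow> b = 0" for a b :: real
  proof (cases "a = 0")
    case False
    then have "a > 0" using that by simp
    have "((\<lambda>e. (1 - (1 + e)) * b + (1 + e) * a) \<longlongrightarrow> (1 - (1 + 0)) * b + (1 + 0) * a) (at_right 0)"
      by (intro tendsto_intros)
    then have "\<forall>\<^sub>F e in at_right 0. 0 < (1 - (1 + e)) * b + (1 + e) * a"
      using \<open>a > 0\<close> by (intro order_tendstoD) auto
    then show ?thesis by eventually_elim simp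
  qed (use that in auto)
  have "\<forall>\<^sub>F e in at_right 0. \<forall>k\<in>K. 0 \<le> (1 - (1 + e)) * f k y + (1 + e) * f k x
      \<and> 0 \<le> (1 - (1 + e)) * g k y + (1 + e) * g k x"
    using finite_K assms by (intro eventually_ball_finite ballI eventually_conj small) (auto simp: f_nonneg g_nonneg)
  moreover have "\<forall>\<^sub>F e :: real in at_right 0. 0 < e" by (simp add: eventually_at_right_less)
  ultimately have "\<forall>\<^sub>F e in at_right 0. 0 < e \<and> (1 - (1 + e)) *\<^sub>R y + (1 + e) *\<^sub>R x \<in> P"
  proof eventually_elim
    case (elim e)
    have "(1 - (1 + e)) *\<^sub>R y + (1 + e) *\<^sub>R x \<in> V" by (rule segment_in_V[OF V(2,1)])
    then show ?case using elim unfolding P_eq by (simp only: mem_Collect_eq f_affine[OF V(2,1)] g_affine[OF V(2,1)])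
  qed
  then obtain e :: real where "0 < e \<and> (1 - (1 + e)) *\<^sub>R y + (1 + e) *\<^sub>R x \<in> P"
    using eventually_happens trivial_limit_at_right_real by blast
  then show thesis using that by blast
qed

text \<open>S and T collect what is tight at a relative interior point x of F. A point y of the
  tight face lies in F because the segment from y through x can be prolonged within P, so that x is
  interior to a segment in P and the face property applies.\<close>

lemma face_eq_tight_face:
  assumes F: "F face_of P" "F \<noteq> {}"
  obtains S T where "(S, T) \<in> signed_sets" "F = tight_face (S, T)"
proof -
  have "convex F" "F \<subseteq> P" using face_of_imp_convex[OF F(1)] face_of_imp_subset[OF F(1)] by auto
  then obtain x where x: "x \<in> rel_interior F"
    using F(2) rel_interior_eq_empty by auto
  then have "x \<in> F" "x \<in> P" using rel_interior_subset \<open>F \<subseteq> P\<close> by auto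
  define S where "S = {k \<in> K. f k x = 0}"
  define T where "T = {k \<in> K. g k x = 0}"
  have "F = tight_face (S, T)"
  proof (intro equalityI subsetI)
    fix y assume "y \<in> F"
    then have "y \<in> affine hull F" by (simp add: hull_inc)
    then obtain m :: real where m: "m > 1" "(1 - m) *\<^sub>R y + m *\<^sub>R x \<in> F"
      using convex_rel_interior_if[OF \<open>convex F\<close> x] by (metis order_refl)
    \<comment> \<open>\<open>x\<close> lies between \<open>y\<close> and \<open>w\<close>, so what is tight at \<open>x\<close> is tight at \<open>y\<close>.\<close>
    let ?w = "(1 - m) *\<^sub>R y + m *\<^sub>R x"
    have wy: "?w \<in> P" "y \<in> P" using m(2) \<open>y \<in> F\<close> \<open>F \<subseteq> P\<close> by auto
    then have V: "?w \<in> V" "y \<in> V" "x \<in> V" using P_sub_V \<open>x \<in> P\<close> by auto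
    have "f k y = 0" if "k \<in> S" for k
    proof -
      have "0 \<le> (1 - m) * f k y + m * f k x"
        using f_nonneg[OF wy(1)] that unfolding S_def f_affine[OF V(2,3), symmetric] by auto
      moreover have "0 \<le> f k y" "f k x = 0" using that f_nonneg[OF wy(2)] by (auto simp: S_def)
      ultimately show ?thesis using m(1) by (simp add: zero_le_mult_iff)
    qed
    moreover have "g k y = 0" if "k \<in> T" for k
    proof -
      have "0 \<le> (1 - m) * g k y + m * g k x"
        using g_nonneg[OF wy(1)] that unfolding T_def g_affine[OF V(2,3), symmetric] by auto
      moreover have "0 \<le> g k y" "g k x = 0" using that g_nonneg[OF wy(2)] by (auto simp: T_def)
      ultimately show ?thesis using m(1) by (simp add: zero_le_mult_iff)
    qed
    ultimately show "y \<in> tight_face (S, T)" using wy by (auto simp: tight_face_def)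
  next
    fix y assume "y \<in> tight_face (S, T)"
    then have y: "y \<in> P" "\<And>k. k \<in> K \<Longrightarrow> f k x = 0 \<Longrightarrow> f k y = 0" "\<And>k. k \<in> K \<Longrightarrow> g k x = 0 \<Longrightarrow> g k y = 0"
      by (auto simp: tight_face_def S_def T_def)
    show "y \<in> F"
    proof (cases "y = x")
      case False
      obtain e :: real where e: "e > 0" "(1 - (1 + e)) *\<^sub>R y + (1 + e) *\<^sub>R x \<in> P"
        using prolong_in_P[OF \<open>x \<in> P\<close> y(1)] y(2,3) by blast
      let ?w = "(1 - (1 + e)) *\<^sub>R y + (1 + e) *\<^sub>R x"
      have x_eq: "x = (1 - 1 / (1 + e)) *\<^sub>R y + (1 / (1 + e)) *\<^sub>R ?w"
      proof -
        have "(1 / (1 + e)) *\<^sub>R ?w = ((1 / (1 + e)) * (1 - (1 + e))) *\<^sub>R y + ((1 / (1 + e)) * (1 + e)) *\<^sub>R x"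
          by (simp only: scaleR_add_right scaleR_scaleR)
        also have "(1 / (1 + e)) * (1 + e) = 1" using e by simp
        also have "(1 / (1 + e)) * (1 - (1 + e)) = - (1 - 1 / (1 + e))" using e by (simp add: field_simps)
        finally show ?thesis by (simp add: algebra_simps)
      qed
      moreover have "y \<noteq> ?w"
      proof
        assume "y = ?w"
        then have "(1 + e) *\<^sub>R y = (1 + e) *\<^sub>R x" by (simp add: algebra_simps)
        then show False using False e by simp
      qed
      moreover have "0 < 1 / (1 + e)" "1 / (1 + e) < 1" using e by auto
      ultimately have "x \<in> open_segment y ?w" unfolding in_segment by blast
      then show ?thesis using F(1) y(1) e(2) \<open>x \<in> F\<close> by (auto simp: face_of_def)
    qed (use \<open>x \<in> F\<close> in auto)
  qed
  moreover have "(S, T) \<in> signed_sets"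
    using opposite \<open>x \<in> P\<close> by (auto simp: signed_sets_def S_def T_def)
  ultimately show thesis using that by blast
qed

lemma bij_betw_tight_face: "bij_betw tight_face signed_sets {F. F face_of P \<and> F \<noteq> {}}"
  unfolding bij_betw_def
proof
  show "inj_on tight_face signed_sets"
  proof (rule inj_onI)
    fix p q assume "p \<in> signed_sets" "q \<in> signed_sets" "tight_face p = tight_face q"
    then show "p = q"
      using tight_face_subset_iff by (cases p, cases q) (metis order_antisym order_refl)
  qed
  show "tight_face ` signed_sets = {F. F face_of P \<and> F \<noteq> {}}"
    by (auto simp: tight_face_nonempty elim!: face_eq_tight_face)
      (auto simp: signed_sets_def intro: tight_face_face_of)
qed

text \<open>By Minkowski's theorem only extreme points matter. An extreme point is a face {x} =
  \<open>tight_face (S, T)\<close>, and since \<open>v S\<close> belongs to that face it must be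
  x.\<close>

lemma compact_eq_hull:
  assumes "compact P"
  shows "P = convex hull (v ` Pow K)"
proof
  have "x \<in> v ` Pow K" if "x extreme_point_of P" for x
  proof -
    have "{x} face_of P" using that by (simp add: face_of_singleton)
    then obtain S T where ST: "(S, T) \<in> signed_sets" "{x} = tight_face (S, T)"
      using face_eq_tight_face by blast
    then have sub: "S \<subseteq> K" "T \<subseteq> K" "S \<inter> T = {}" by (auto simp: signed_sets_def)
    have "v S \<in> tight_face (S, T)"
      using sub by (auto simp: tight_face_def v_in f_v_iff g_v_iff subset_iff)
    then have "v S = x" using ST(2) by blast
    then show ?thesis using sub by blast
  qed
  then show "P \<subseteq> convex hull (v ` Pow K)"
    using Krein_Milman_Minkowski[OF assms convex_P] hull_mono[of "{x. x extreme_point_of P}" "v ` Pow K" convex]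
    by blast
  show "convex hull (v ` Pow K) \<subseteq> P"
    using v_in convex_P by (intro hull_minimal) auto
qed

end

text \<open>Both sets of nonempty faces are indexed by the same disjoint pairs of subsets of K, and
  inclusion is read off the pairs in the same way. The empty face has no index and is matched
  separately.\<close>

theorem combinatorially_equivalent_cube_like:
  assumes "cube_like_polyhedron V K f g v P" "cube_like_polyhedron V' K f' g' v' P'"
  shows "combinatorially_equivalent P P'"
proof -
  interpret A: cube_like_polyhedron V K f g v P by fact
  interpret B: cube_like_polyhedron V' K f' g' v' P' by fact
  define u where "u = inv_into A.signed_sets A.tight_face"
  define \<phi> where "\<phi> F = (if F = {} then {} else B.tight_face (u F))" for F
  have u: "bij_betw u {F. F face_of P \<and> F \<noteq> {}} A.signed_sets"
    unfolding u_def by (rule bij_betw_inv_into[OF A.bij_betw_tight_face])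
  from bij_betw_trans[OF u B.bij_betw_tight_face]
  have "bij_betw (B.tight_face \<circ> u) {F. F face_of P \<and> F \<noteq> {}} {F. F face_of P' \<and> F \<noteq> {}}" .
  moreover have "bij_betw \<phi> {F. F face_of P \<and> F \<noteq> {}} {F. F face_of P' \<and> F \<noteq> {}}
      \<longleftrightarrow> bij_betw (B.tight_face \<circ> u) {F. F face_of P \<and> F \<noteq> {}} {F. F face_of P' \<and> F \<noteq> {}}"
    by (intro bij_betw_cong) (simp add: \<phi>_def)
  ultimately have "bij_betw \<phi> {F. F face_of P \<and> F \<noteq> {}} {F. F face_of P' \<and> F \<noteq> {}}" by blast
  moreover have "bij_betw \<phi> {{}} {{}}" by (simp add: \<phi>_def)
  ultimately have "bij_betw \<phi> ({F. F face_of P \<and> F \<noteq> {}} \<union> {{}}) ({F. F face_of P' \<and> F \<noteq> {}} \<union> {{}})"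
    by (rule bij_betw_combine) auto
  moreover have "{F. F face_of P \<and> F \<noteq> {}} \<union> {{}} = {F. F face_of P}"
    "{F. F face_of P' \<and> F \<noteq> {}} \<union> {{}} = {F. F face_of P'}"
    by auto
  ultimately have "bij_betw \<phi> {F. F face_of P} {F. F face_of P'}" by (simp only:)
  moreover have "F \<subseteq> G \<longleftrightarrow> \<phi> F \<subseteq> \<phi> G" if FG: "F face_of P" "G face_of P" for F G
  proof (cases "F = {} \<or> G = {}")
    case True
    have "\<phi> F \<noteq> {}" if "F \<noteq> {}" "F face_of P" for F
    proof -
      have "u F \<in> A.signed_sets" using bij_betw_apply[OF u] that by blast
      then show ?thesis using that B.tight_face_nonempty by (simp add: \<phi>_def)
    qed
    then show ?thesis using True FG by (auto simp: \<phi>_def)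
  next
    case False
    then have uFG: "u F \<in> A.signed_sets" "u G \<in> A.signed_sets"
      using u FG by (auto simp: bij_betw_def)
    have "A.tight_face (u F) = F" "A.tight_face (u G) = G"
      using False FG A.bij_betw_tight_face by (auto simp: u_def bij_betw_def intro!: f_inv_into_f)
    have iff: "A.tight_face p \<subseteq> A.tight_face q \<longleftrightarrow> B.tight_face p \<subseteq> B.tight_face q"
      if "p \<in> A.signed_sets" "q \<in> A.signed_sets" for p q
    proof -
      obtain S T S' T' where "p = (S, T)" "q = (S', T')" by (meson surj_pair)
      then show ?thesis
        using that A.tight_face_subset_iff[of S T S' T'] B.tight_face_subset_iff[of S T S' T'] by simp
    qed
    from iff[OF uFG] \<open>A.tight_face (u F) = F\<close> \<open>A.tight_face (u G) = G\<close>
    have "F \<subseteq> G \<longleftrightarrow> B.tight_face (u F) \<subseteq> B.tight_face (u G)" by simp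
    then show ?thesis using False by (simp add: \<phi>_def)
  qed
  ultimately show ?thesis unfolding combinatorially_equivalent_def by blast
qed

section \<open>Words avoiding 132 and 213\<close>

lemma coord_pos_strict_mono: "i < j \<Longrightarrow> coord_pos i < coord_pos (j :: 'n::{finite,wellorder})"
  unfolding coord_pos_def by (intro psubset_card_mono) auto

lemma coord_pos_le_iff: "coord_pos i \<le> coord_pos j \<longleftrightarrow> i \<le> (j :: 'n::{finite,wellorder})"
  by (metis coord_pos_strict_mono linorder_not_le order_le_less)

lemma bij_betw_coord_pos: "bij_betw (coord_pos :: 'n::{finite,wellorder} \<Rightarrow> nat) UNIV {..<CARD('n)}"
proof -
  have inj: "inj (coord_pos :: 'n \<Rightarrow> nat)"
    by (metis coord_pos_strict_mono injI less_irrefl neqE)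
  have "coord_pos i < CARD('n)" for i :: 'n
    unfolding coord_pos_def by (intro psubset_card_mono) auto
  then have "coord_pos ` (UNIV :: 'n set) \<subseteq> {..<CARD('n)}" by auto
  then have "coord_pos ` (UNIV :: 'n set) = {..<CARD('n)}"
    using inj by (intro card_subset_eq) (auto simp: card_image)
  with inj show ?thesis by (simp add: bij_betw_def)
qed

lemma coord_pos_less_CARD: "coord_pos (i :: 'n::{finite,wellorder}) < CARD('n)"
  using bij_betw_apply[OF bij_betw_coord_pos, of i] by simp

text \<open>Coordinates by position, counted from 0; a junk value for positions beyond the dimension.\<close>

definition coord :: "'a ^ 'n::{finite,wellorder} \<Rightarrow> nat \<Rightarrow> 'a" where
  "coord x k = x $ inv coord_pos k"

lemma coord_coord_pos [simp]:
  fixes x :: "'a ^ 'n::{finite,wellorder}"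
  shows "coord x (coord_pos i) = x $ i"
  using bij_betw_coord_pos[where 'n = 'n] by (simp add: coord_def bij_betw_def)

lemma coord_vec_lambda: "k < CARD('n) \<Longrightarrow> coord (\<chi> i :: 'n::{finite,wellorder}. h (coord_pos i)) k = h k"
  using bij_betw_coord_pos[where 'n = 'n] by (simp add: coord_def bij_betw_def f_inv_into_f)

lemma coord_vec_of_list: "k < CARD('n) \<Longrightarrow> coord (vec_of_list w :: real ^ 'n::{finite,wellorder}) k = real (w ! k)"
  unfolding vec_of_list_def by (rule coord_vec_lambda)

lemma sum_coord_pos_less:
  fixes x :: "real ^ 'n::{finite,wellorder}"
  assumes "k \<le> CARD('n)"
  shows "(\<Sum>i | coord_pos i < k. x $ i) = (\<Sum>j<k. coord x j)"
proof -
  have "bij_betw (coord_pos :: 'n \<Rightarrow> nat) {i. coord_pos i < k} {..<k}"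
    unfolding bij_betw_def
  proof
    show "inj_on (coord_pos :: 'n \<Rightarrow> nat) {i. coord_pos i < k}"
      using bij_betw_coord_pos[where 'n = 'n] by (auto simp: bij_betw_def intro: inj_on_subset)
    have "j \<in> coord_pos ` {i :: 'n. coord_pos i < k}" if "j < k" for j
    proof -
      have "j \<in> coord_pos ` (UNIV :: 'n set)"
        using that assms bij_betw_coord_pos[where 'n = 'n] by (simp add: bij_betw_def)
      then show ?thesis using that by blast
    qed
    then show "coord_pos ` {i :: 'n. coord_pos i < k} = {..<k}" by auto
  qed
  from sum.reindex_bij_betw[OF this, of "coord x"] show ?thesis by simp
qed

lemma sum_coords:
  fixes x :: "real ^ 'n::{finite,wellorder}"
  shows "(\<Sum>i\<in>UNIV. x $ i) = (\<Sum>j<CARD('n). coord x j)"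
  using sum_coord_pos_less[of "CARD('n)" x] by (simp add: coord_pos_less_CARD)

section \<open>The patterns 132 and 213 as conditions on three positions\<close>

lemma subseq_nth_Cons:
  assumes "i < length w" "subseq u (drop (Suc i) w)"
  shows "subseq (w ! i # u) w"
proof -
  have "subseq (w ! i # u) (w ! i # drop (Suc i) w)" using assms(2) by simp
  then have "subseq (w ! i # u) (take i w @ w ! i # drop (Suc i) w)" by (rule list_emb_append2)
  then show ?thesis using assms(1) by (simp flip: id_take_nth_drop)
qed

lemma subseq_3_iff:
  "subseq [x, y, z] w \<longleftrightarrow> (\<exists>i j k. i < j \<and> j < k \<and> k < length w \<and> x = w ! i \<and> y = w ! j \<and> z = w ! k)"
proof
  assume "subseq [x, y, z] w"
  then obtain us vs where 1: "w = us @ x # vs" "subseq [y, z] vs"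
    using list_emb_ConsD[of "(=)" x "[y, z]" w] by blast
  from 1(2) obtain us' vs' where 2: "vs = us' @ y # vs'" "subseq [z] vs'"
    using list_emb_ConsD[of "(=)" y "[z]" vs] by blast
  from 2(2) obtain us'' vs'' where 3: "vs' = us'' @ z # vs''"
    using list_emb_ConsD[of "(=)" z "[]" vs'] by blast
  show "\<exists>i j k. i < j \<and> j < k \<and> k < length w \<and> x = w ! i \<and> y = w ! j \<and> z = w ! k"
    by (rule exI[of _ "length us"], rule exI[of _ "length us + Suc (length us')"],
        rule exI[of _ "length us + Suc (length us' + Suc (length us''))"])
      (simp add: 1 2 3 nth_append)
next
  assume "\<exists>i j k. i < j \<and> j < k \<and> k < length w \<and> x = w ! i \<and> y = w ! j \<and> z = w ! k"
  then obtain i j k where ijk: "i < j" "j < k" "k < length w" "x = w ! i" "y = w ! j" "z = w ! k" by blast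
  have "subseq [z] (drop (Suc (j - Suc i)) (drop (Suc i) w))"
    using subseq_nth_Cons[of "k - Suc j" "drop (Suc j) w" "[]"] ijk by simp
  then have "subseq [y, z] (drop (Suc i) w)"
    using subseq_nth_Cons[of "j - Suc i" "drop (Suc i) w" "[z]"] ijk by simp
  then show "subseq [x, y, z] w"
    using subseq_nth_Cons[of i w "[y, z]"] ijk by simp
qed

lemma avoids_132_iff:
  "avoids w [1, 3, 2] \<longleftrightarrow> \<not> (\<exists>i j k. i < j \<and> j < k \<and> k < length w \<and> w ! i < w ! k \<and> w ! k < w ! j)"
proof -
  have *: "same_relative_order u [1, 3, 2] \<longleftrightarrow> (\<exists>x y z. u = [x, y, z] \<and> x < z \<and> z < y)" for u
  proof -
    have "same_relative_order [x, y, z] [1, 3, 2] \<longleftrightarrow> x < z \<and> z < y" for x y z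
      by (auto simp: same_relative_order_def All_less_Suc)
    moreover have "same_relative_order u [1, 3, 2] \<Longrightarrow> \<exists>x y z. u = [x, y, z]"
      by (auto simp: same_relative_order_def length_Suc_conv)
    ultimately show ?thesis by blast
  qed
  have "avoids w [1, 3, 2] \<longleftrightarrow> \<not> (\<exists>x y z. subseq [x, y, z] w \<and> x < z \<and> z < y)"
    unfolding avoids_def * by fast
  then show ?thesis unfolding subseq_3_iff by fast
qed

lemma avoids_213_iff:
  "avoids w [2, 1, 3] \<longleftrightarrow> \<not> (\<exists>i j k. i < j \<and> j < k \<and> k < length w \<and> w ! j < w ! i \<and> w ! i < w ! k)"
proof -
  have *: "same_relative_order u [2, 1, 3] \<longleftrightarrow> (\<exists>x y z. u = [x, y, z] \<and> y < x \<and> x < z)" for u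
  proof -
    have "same_relative_order [x, y, z] [2, 1, 3] \<longleftrightarrow> y < x \<and> x < z" for x y z
      by (auto simp: same_relative_order_def All_less_Suc)
    moreover have "same_relative_order u [2, 1, 3] \<Longrightarrow> \<exists>x y z. u = [x, y, z]"
      by (auto simp: same_relative_order_def length_Suc_conv)
    ultimately show ?thesis by blast
  qed
  have "avoids w [2, 1, 3] \<longleftrightarrow> \<not> (\<exists>x y z. subseq [x, y, z] w \<and> y < x \<and> x < z)"
    unfolding avoids_def * by fast
  then show ?thesis unfolding subseq_3_iff by fast
qed

section \<open>Inequalities satisfied by avoiding words\<close>

text \<open>If the word jumps from v to more than v + 1, the value v + 1 stands elsewhere: to the
  left of the jump it completes a 213, to the right a 132.\<close>

lemma avoiding_step_le:
  assumes w: "set w = {1..d}" "distinct w" and av: "avoids w [1, 3, 2]" "avoids w [2, 1, 3]"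
    and k: "0 < k" "k < length w"
  shows "w ! k \<le> w ! (k - 1) + 1"
proof (rule ccontr)
  assume gt: "\<not> w ! k \<le> w ! (k - 1) + 1"
  have "w ! k \<le> d" using w(1) k nth_mem by fastforce
  then have "w ! (k - 1) + 1 \<in> set w" using gt w(1) by simp
  then obtain p where p: "p < length w" "w ! p = w ! (k - 1) + 1" by (auto simp: in_set_conv_nth)
  then have "p \<noteq> k" "p \<noteq> k - 1" using gt by auto
  then consider "p < k - 1" | "k < p" using k by linarith
  then show False
  proof cases
    case 1
    then have "p < k - 1 \<and> k - 1 < k \<and> k < length w \<and> w ! (k - 1) < w ! p \<and> w ! p < w ! k"
      using gt p k by auto
    then show ?thesis using av(2) unfolding avoids_213_iff by blast
  next
    case 2
    then have "k - 1 < k \<and> k < p \<and> p < length w \<and> w ! (k - 1) < w ! p \<and> w ! p < w ! k"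
      using gt p k by auto
    then show ?thesis using av(1) unfolding avoids_132_iff by blast
  qed
qed

text \<open>The bound is d + (d-1) + ... + (d-k+1) in closed form. In the induction the minimum is
  removed; the k other elements lie above it and below d + 1, so it is at most d - k.\<close>

lemma sum_le_sum_largest:
  assumes "T \<subseteq> {1..d}" "card T = k"
  shows "real (\<Sum>T) \<le> real k * real d - real k * (real k - 1) / 2"
  using assms
proof (induction k arbitrary: T)
  case 0
  then have "T = {}" by (metis card_0_eq finite_atLeastAtMost finite_subset)
  then show ?case by simp
next
  case (Suc k)
  have fin: "finite T" using Suc.prems(1) finite_subset by blast
  moreover have "T \<noteq> {}" using Suc.prems(2) by auto
  ultimately have m: "Min T \<in> T" by simp
  have "T \<subseteq> {Min T..d}" using Suc.prems(1) fin by auto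
  then have "card T \<le> card {Min T..d}" by (rule card_mono[rotated]) simp
  moreover have "Min T \<le> d" using m Suc.prems(1) by auto
  ultimately have "Min T + k \<le> d" using Suc.prems(2) by simp
  moreover have "real (\<Sum>(T - {Min T})) \<le> real k * real d - real k * (real k - 1) / 2"
    using Suc.prems m fin by (intro Suc.IH) auto
  moreover have "\<Sum>T = Min T + \<Sum>(T - {Min T})" using m fin by (simp add: sum.remove)
  ultimately have "real (\<Sum>T) \<le> real d - real k + (real k * real d - real k * (real k - 1) / 2)"
    by (smt (verit) of_nat_add of_nat_mono)
  then show ?case by (simp add: field_simps)
qed

lemma sum_interval_largest:
  assumes "k \<le> d"
  shows "real (\<Sum>{Suc (d - k)..d}) = real k * real d - real k * (real k - 1) / 2"
  using assms
proof (induction k)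
  case (Suc k)
  have "{Suc (d - Suc k)..d} = insert (d - k) {Suc (d - k)..d}" using Suc.prems by auto
  then have "\<Sum>{Suc (d - Suc k)..d} = (d - k) + \<Sum>{Suc (d - k)..d}" by simp
  then show ?case using Suc by (simp add: of_nat_diff field_simps)
qed simp

text \<open>The descending blocks of consecutive values that start at the positions in \<open>S\<close> and at 0.\<close>

definition block_start :: "nat set \<Rightarrow> nat \<Rightarrow> nat" where
  "block_start S i = Max (insert 0 {s \<in> S. s \<le> i})"

definition block_end :: "nat \<Rightarrow> nat set \<Rightarrow> nat \<Rightarrow> nat" where
  "block_end d S i = Min (insert d {s \<in> S. i < s})"

text \<open>The block of positions s, ..., e - 1 carries the values d - e + 1, ..., d - s in
  increasing order, so position i gets d - e + 1 + (i - s). Adding first keeps the natural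
  subtractions from being cut off at 0.\<close>

definition block_value :: "nat \<Rightarrow> nat set \<Rightarrow> nat \<Rightarrow> nat" where
  "block_value d S i = d + 1 + i - block_start S i - block_end d S i"

definition block_word :: "nat \<Rightarrow> nat set \<Rightarrow> nat list" where
  "block_word d S = map (block_value d S) [0..<d]"

context
  fixes d :: nat and S :: "nat set"
  assumes S: "S \<subseteq> {1..<d}"
begin

lemma finite_S: "finite S" using S finite_subset by blast

lemma block_start_le: "block_start S i \<le> i"
  unfolding block_start_def using finite_S by (intro Max.boundedI) auto

lemma block_start_ge: "s \<in> S \<Longrightarrow> s \<le> i \<Longrightarrow> s \<le> block_start S i"
  unfolding block_start_def using finite_S by (intro Max_ge) auto

lemma block_end_gt: "i < d \<Longrightarrow> i < block_end d S i"
  unfolding block_end_def using finite_S by (subst Min_gr_iff) auto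

lemma block_end_le: "s \<in> S \<Longrightarrow> i < s \<Longrightarrow> block_end d S i \<le> s" "block_end d S i \<le> d"
  unfolding block_end_def using finite_S by (intro Min_le; auto)+

lemma block_value_same_block:
  assumes "i < j" "j < d" "\<And>s. s \<in> S \<Longrightarrow> i < s \<Longrightarrow> j < s"
  shows "block_value d S j = block_value d S i + (j - i)"
proof -
  have "{s \<in> S. s \<le> j} = {s \<in> S. s \<le> i}" "{s \<in> S. j < s} = {s \<in> S. i < s}"
    using assms(1,3) by (auto, meson not_le order.strict_trans2 leD)
  then have "block_start S j = block_start S i" "block_end d S j = block_end d S i"
    by (simp_all add: block_start_def block_end_def)
  then show ?thesis
    using assms(1) block_start_le[of i] block_end_le(2)[of i] by (simp add: block_value_def)
qed

lemma block_value_bounds: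
  assumes "i < d"
  shows "d - block_end d S i < block_value d S i" "block_value d S i \<le> d - block_start S i"
  using block_start_le[of i] block_end_gt[OF assms] block_end_le(2)[of i] by (auto simp: block_value_def)

lemma block_value_later_block:
  assumes "s \<in> S" "i < s" "s \<le> j" "j < d"
  shows "block_value d S j < block_value d S i"
  using block_value_bounds[of i] block_value_bounds[of j] block_end_le(1)[OF assms(1,2)]
    block_start_ge[OF assms(1,3)] assms by linarith

lemma block_value_cases:
  assumes "i < j" "j < d"
  obtains (same) "block_value d S j = block_value d S i + (j - i)" "\<And>s. s \<in> S \<Longrightarrow> i < s \<Longrightarrow> j < s"
  | (later) s where "s \<in> S" "i < s" "s \<le> j" "block_value d S j < block_value d S i"
proof (cases "\<exists>s\<in>S. i < s \<and> s \<le> j")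
  case True
  then show ?thesis using later block_value_later_block assms by blast
next
  case False
  then have "\<And>s. s \<in> S \<Longrightarrow> i < s \<Longrightarrow> j < s" by (meson not_le)
  then show ?thesis using same block_value_same_block assms by blast
qed

text \<open>A rise between two positions, however far apart, puts them in one block, and everything
  between them then rises as well. In 132 and in 213 the last entry exceeds the first although there
  is a descent in between, so neither can occur.\<close>

lemma block_value_less_imp_same_block:
  assumes "i < j" "j < d" "block_value d S i < block_value d S j" "i \<le> i'" "i' < j'" "j' \<le> j"
  shows "block_value d S i' < block_value d S j'"
  using assms(1,2)
proof (cases rule: block_value_cases)
  case same
  then have "\<And>s. s \<in> S \<Longrightarrow> i' < s \<Longrightarrow> j' < s" using assms by (meson le_less_trans)
  then show ?thesis using block_value_same_block[of i' j'] assms by simp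
qed (use assms in auto)

lemma inj_on_block_value: "inj_on (block_value d S) {..<d}"
proof (rule linorder_inj_onI)
  fix i j assume "i < j" "i \<in> {..<d}" "j \<in> {..<d}"
  then have ij: "i < j" "j < d" by auto
  from ij show "block_value d S i \<noteq> block_value d S j"
    by (cases rule: block_value_cases) (use ij in auto)
qed auto

lemma block_value_image: "block_value d S ` {..<d} = {1..d}"
proof (rule card_subset_eq)
  show "block_value d S ` {..<d} \<subseteq> {1..d}"
    using block_value_bounds by (fastforce simp: Suc_le_eq)
qed (simp_all add: card_image inj_on_block_value)

lemma block_word_avoiding: "block_word d S \<in> avoiding_permutations d {[1, 3, 2], [2, 1, 3]}"
proof -
  have "block_word d S \<in> permutations_of_set {1..d}"
    unfolding permutations_of_set_def block_word_def
    using inj_on_block_value block_value_image by (simp add: distinct_map atLeast0LessThan)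
  moreover have nth: "block_word d S ! i = block_value d S i" if "i < d" for i
    using that by (simp add: block_word_def)
  have len: "length (block_word d S) = d" by (simp add: block_word_def)
  have "avoids (block_word d S) [1, 3, 2]"
    unfolding avoids_132_iff len
  proof (intro notI, elim exE conjE)
    fix i j k assume *: "i < j" "j < k" "k < d" "block_word d S ! i < block_word d S ! k"
      "block_word d S ! k < block_word d S ! j"
    then have "block_value d S j < block_value d S k"
      using block_value_less_imp_same_block[of i k j k] by (simp add: nth)
    then show False using * by (simp add: nth)
  qed
  moreover have "avoids (block_word d S) [2, 1, 3]"
    unfolding avoids_213_iff len
  proof (intro notI, elim exE conjE)
    fix i j k assume *: "i < j" "j < k" "k < d" "block_word d S ! j < block_word d S ! i"
      "block_word d S ! i < block_word d S ! k"
    then have "block_value d S i < block_value d S j"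
      using block_value_less_imp_same_block[of i k i j] by (simp add: nth)
    then show False using * by (simp add: nth)
  qed
  ultimately show ?thesis by (simp add: avoiding_permutations_def)
qed

text \<open>Every block before k ends by k, so its values exceed d - k, and counting does the rest.
  This makes \<open>top_slack\<close> vanish at the elements of S.\<close>

lemma block_value_image_initial:
  assumes "k \<in> S"
  shows "block_value d S ` {..<k} = {Suc (d - k)..d}"
proof (rule card_subset_eq)
  have kd: "k < d" "k \<le> d" using assms S by auto
  show "block_value d S ` {..<k} \<subseteq> {Suc (d - k)..d}"
  proof
    fix x assume "x \<in> block_value d S ` {..<k}"
    then obtain i where i: "i < k" "x = block_value d S i" by auto
    then have "d - block_end d S i < x" "x \<le> d" "block_end d S i \<le> k"
      using block_value_bounds[of i] block_end_le(1)[OF assms, of i] kd by auto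
    then show "x \<in> {Suc (d - k)..d}" by auto
  qed
  have "inj_on (block_value d S) {..<k}" by (rule inj_on_subset[OF inj_on_block_value]) (use kd in auto)
  then show "card (block_value d S ` {..<k}) = card {Suc (d - k)..d}"
    using kd by (simp add: card_image)
qed simp

end

section \<open>The avoidance polytope by inequalities\<close>

definition top_slack :: "real ^ 'n::{finite,wellorder} \<Rightarrow> nat \<Rightarrow> real" where
  "top_slack x k = real k * real CARD('n) - real k * (real k - 1) / 2 - (\<Sum>j<k. coord x j)"

text \<open>Positions count from 0, so \<open>coord x (k - 1)\<close> and \<open>coord x k\<close>
  are the k-th and (k+1)-st coordinates.\<close>

definition step_slack :: "real ^ 'n::{finite,wellorder} \<Rightarrow> nat \<Rightarrow> real" where
  "step_slack x k = 1 + coord x (k - 1) - coord x k"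

text \<open>The coordinate sum d (d + 1) / 2, expressed as the vanishing of the last slack; together
  with \<open>top_slack_0\<close> this supplies the two boundary zeros.\<close>

definition sum_hyperplane :: "(real ^ 'n::{finite,wellorder}) set" where
  "sum_hyperplane = {x. top_slack x CARD('n) = 0}"

definition slack_polytope :: "(real ^ 'n::{finite,wellorder}) set" where
  "slack_polytope = {x \<in> sum_hyperplane. \<forall>k\<in>{1..<CARD('n)}. 0 \<le> top_slack x k \<and> 0 \<le> step_slack x k}"

lemma coord_affine: "coord ((1 - t) *\<^sub>R x + t *\<^sub>R y) k = (1 - t) * coord x k + t * coord y k"
  for x y :: "real ^ 'n::{finite,wellorder}"
  by (simp add: coord_def)

lemma top_slack_affine: "top_slack ((1 - t) *\<^sub>R x + t *\<^sub>R y) k = (1 - t) * top_slack x k + t * top_slack y k"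
proof -
  have "A - ((1 - t) * X + t * Y) = (1 - t) * (A - X) + t * (A - Y)" for A X Y :: real
    by (simp add: algebra_simps)
  then show ?thesis
    by (simp add: top_slack_def coord_affine sum.distrib flip: sum_distrib_left)
qed

lemma step_slack_affine: "step_slack ((1 - t) *\<^sub>R x + t *\<^sub>R y) k = (1 - t) * step_slack x k + t * step_slack y k"
  by (simp add: step_slack_def coord_affine) (simp add: algebra_simps)

lemma affine_sum_hyperplane: "affine sum_hyperplane"
  unfolding affine_alt sum_hyperplane_def by (simp add: top_slack_affine)

lemma top_slack_0: "top_slack x 0 = 0" by (simp add: top_slack_def)

lemma top_slack_Suc: "top_slack (x :: real ^ 'n::{finite,wellorder}) (Suc k) = top_slack x k + real CARD('n) - real k - coord x k"
  by (simp add: top_slack_def field_simps)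

lemma step_slack_eq_second_difference:
  assumes "0 < k"
  shows "step_slack x k = 2 - (2 * top_slack x k - top_slack x (k - 1) - top_slack x (k + 1))"
proof -
  obtain m where "k = Suc m" using assms by (cases k) auto
  then show ?thesis by (simp add: step_slack_def top_slack_Suc)
qed

lemma top_slack_vec_of_list:
  fixes w :: "nat list"
  assumes "distinct w" "length w = CARD('n)" "k \<le> CARD('n)"
  shows "top_slack (vec_of_list w :: real ^ 'n::{finite,wellorder}) k
    = real k * real CARD('n) - real k * (real k - 1) / 2 - real (\<Sum>((!) w ` {..<k}))"
proof -
  have "inj_on ((!) w) {..<k}" using assms by (auto simp: inj_on_def nth_eq_iff_index_eq)
  then have "\<Sum>((!) w ` {..<k}) = (\<Sum>j<k. w ! j)" by (simp add: sum.reindex)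
  moreover have "(\<Sum>j<k. coord (vec_of_list w :: (real, 'n) vec) j) = (\<Sum>j<k. real (w ! j))"
    using assms(3) by (intro sum.cong) (auto simp: coord_vec_of_list)
  ultimately show ?thesis by (simp add: top_slack_def)
qed

lemma avoiding_in_slack_polytope:
  assumes "w \<in> avoiding_permutations CARD('n) {[1, 3, 2], [2, 1, 3]}"
  shows "(vec_of_list w :: real ^ 'n::{finite,wellorder}) \<in> slack_polytope"
proof -
  let ?d = "CARD('n)" and ?x = "vec_of_list w :: (real, 'n) vec"
  have w: "set w = {1..?d}" "distinct w" and av: "avoids w [1, 3, 2]" "avoids w [2, 1, 3]"
    using assms by (auto simp: avoiding_permutations_def permutations_of_set_def)
  have len: "length w = ?d" using distinct_card[OF w(2)] w(1) by simp
  have inj: "inj_on ((!) w) {..<k}" if "k \<le> ?d" for k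
    using that len w(2) by (auto simp: inj_on_def nth_eq_iff_index_eq)
  have img: "(!) w ` {..<k} \<subseteq> {1..?d}" if "k \<le> ?d" for k
    using that len w(1) nth_mem by fastforce
  have "(!) w ` {..<?d} = {Suc (?d - ?d)..?d}"
    using img[of ?d] inj[of ?d] by (intro card_subset_eq) (auto simp: card_image)
  then have "top_slack ?x ?d = 0"
    using sum_interval_largest[of ?d ?d] by (simp add: top_slack_vec_of_list[OF w(2) len] del: of_nat_sum)
  moreover have "0 \<le> top_slack ?x k \<and> 0 \<le> step_slack ?x k" if k: "k \<in> {1..<?d}" for k
  proof
    show "0 \<le> top_slack ?x k"
      using sum_le_sum_largest[OF img, of k k] inj[of k] k
      by (simp add: top_slack_vec_of_list[OF w(2) len] card_image del: of_nat_sum)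
    show "0 \<le> step_slack ?x k"
      using avoiding_step_le[OF w av, of k] k len coord_vec_of_list[of "k - 1" w, where 'n = 'n]
      by (auto simp: step_slack_def coord_vec_of_list)
  qed
  ultimately show ?thesis by (simp add: slack_polytope_def sum_hyperplane_def)
qed

lemma top_slack_block_word:
  assumes "S \<subseteq> {1..<CARD('n)}" "k \<in> S"
  shows "top_slack (vec_of_list (block_word CARD('n) S) :: real ^ 'n::{finite,wellorder}) k = 0"
proof -
  let ?d = "CARD('n)"
  have k: "k \<le> ?d" using assms by auto
  have "distinct (block_word ?d S)"
    using block_word_avoiding[OF assms(1)] by (auto simp: avoiding_permutations_def permutations_of_set_def)
  moreover have "length (block_word ?d S) = ?d" by (simp add: block_word_def)
  moreover have "(!) (block_word ?d S) ` {..<k} = {Suc (?d - k)..?d}"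
    unfolding block_value_image_initial[OF assms, symmetric]
    using k by (intro image_cong) (auto simp: block_word_def)
  ultimately show ?thesis
    using k by (simp add: top_slack_vec_of_list sum_interval_largest del: of_nat_sum)
qed

text \<open>Unless k starts a block, positions k - 1 and k are neighbours in one block and carry
  consecutive values.\<close>

lemma step_slack_block_word:
  assumes "S \<subseteq> {1..<CARD('n)}" "k \<in> {1..<CARD('n)} - S"
  shows "step_slack (vec_of_list (block_word CARD('n) S) :: real ^ 'n::{finite,wellorder}) k = 0"
proof -
  have "block_value CARD('n) S k = block_value CARD('n) S (k - 1) + (k - (k - 1))"
  proof (rule block_value_same_block[OF assms(1)])
    show "k < s" if "s \<in> S" "k - 1 < s" for s using that assms(2) by (cases "s = k") auto
  qed (use assms in auto)
  moreover have "k - 1 < CARD('n)" "k < CARD('n)" using assms(2) by auto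
  ultimately show ?thesis
    using assms(2) coord_vec_of_list[of "k - 1"] by (simp add: step_slack_def coord_vec_of_list block_word_def)
qed

lemma top_slack_nonneg:
  fixes x :: "real ^ 'n::{finite,wellorder}"
  assumes "x \<in> slack_polytope" "k \<le> CARD('n)"
  shows "0 \<le> top_slack x k"
proof -
  consider "k = 0" | "k = CARD('n)" | "k \<in> {1..<CARD('n)}" using assms(2) by fastforce
  then show ?thesis
    by cases (use assms in \<open>auto simp: slack_polytope_def sum_hyperplane_def top_slack_0\<close>)
qed

lemma cube_like_slack_polytope:
  "cube_like_polyhedron sum_hyperplane {1..<CARD('n)} (\<lambda>k x. top_slack x k) (\<lambda>k x. step_slack x k)
     (\<lambda>S. vec_of_list (block_word CARD('n) S)) (slack_polytope :: (real ^ 'n::{finite,wellorder}) set)"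
proof
  show "vec_of_list (block_word CARD('n) S) \<in> (slack_polytope :: (real, 'n) vec set)"
    if "S \<subseteq> {1..<CARD('n)}" for S
    by (rule avoiding_in_slack_polytope[OF block_word_avoiding[OF that]])
  fix k and x :: "(real, 'n) vec"
  assume k: "k \<in> {1..<CARD('n)}" and x: "x \<in> slack_polytope" "top_slack x k = 0"
  \<comment> \<open>Where the top slack at k is 0, the second-difference identity makes the step
    slack 2 plus the two neighbouring top slacks, so it is at least 2.\<close>
  have "0 \<le> top_slack x (k - 1)" "0 \<le> top_slack x (k + 1)"
    using k by (auto intro!: top_slack_nonneg[OF x(1)])
  then have "step_slack x k \<ge> 2"
    using k x by (simp add: step_slack_eq_second_difference)
  then show "step_slack x k \<noteq> 0" by simp
qed (simp_all add: affine_sum_hyperplane top_slack_affine step_slack_affine slack_polytope_def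
    top_slack_block_word step_slack_block_word)

text \<open>The first coordinate is at most d and each step adds at most 1, which bounds all
  coordinates by 2 d from above; the fixed coordinate sum then bounds each of them from
  below.\<close>

lemma compact_slack_polytope: "compact (slack_polytope :: (real ^ 'n::{finite,wellorder}) set)"
proof -
  let ?d = "CARD('n)"
  have "closed (slack_polytope :: ((real, 'n) vec) set)"
  proof -
    have "slack_polytope = {x :: (real, 'n) vec. top_slack x ?d = 0} \<inter>
        (\<Inter>k\<in>{1..<?d}. {x. 0 \<le> top_slack x k} \<inter> {x. 0 \<le> step_slack x k})"
      by (auto simp: slack_polytope_def sum_hyperplane_def)
    also have "closed \<dots>"
      unfolding top_slack_def step_slack_def coord_def
      by (intro closed_Int closed_INT ballI closed_Collect_eq closed_Collect_le continuous_intros)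
    finally show ?thesis .
  qed
  moreover have "bounded (slack_polytope :: ((real, 'n) vec) set)"
  proof -
    have "\<bar>x $ i\<bar> \<le> 2 * real ?d * real ?d" if x: "x \<in> slack_polytope" for x :: "(real, 'n) vec" and i
    proof -
      have le: "coord x k \<le> real ?d + real k" if "k < ?d" for k
        using that
      proof (induction k)
        case 0
        then show ?case using top_slack_nonneg[OF x, of 1] by (simp add: top_slack_Suc top_slack_0 Suc_le_eq)
      next
        case (Suc k)
        then have "0 \<le> step_slack x (Suc k)" using x by (auto simp: slack_polytope_def)
        then show ?case using Suc by (simp add: step_slack_def)
      qed
      then have le: "x $ j \<le> 2 * real ?d" for j
        using coord_pos_less_CARD[of j] le[of "coord_pos j"] by simp
      have "(\<Sum>j\<in>UNIV. x $ j) = real ?d * real ?d - real ?d * (real ?d - 1) / 2"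
        using x by (simp add: slack_polytope_def sum_hyperplane_def top_slack_def sum_coords)
      also have "\<dots> \<ge> 0" by (simp add: field_simps)
      finally have "0 \<le> (\<Sum>j\<in>UNIV. x $ j)" by simp
      also have "\<dots> = x $ i + (\<Sum>j\<in>UNIV - {i}. x $ j)" by (simp add: sum.remove)
      also have "(\<Sum>j\<in>UNIV - {i}. x $ j) \<le> (\<Sum>j\<in>UNIV - {i}. 2 * real ?d)"
        by (intro sum_mono le)
      also have "\<dots> = 2 * real ?d * (real ?d - 1)" by (simp add: card_Diff_singleton of_nat_diff)
      finally have "- (2 * real ?d * (real ?d - 1)) \<le> x $ i" by simp
      moreover have "2 * real ?d \<le> 2 * real ?d * real ?d" by simp
      ultimately show ?thesis using le[of i] unfolding abs_le_iff right_diff_distrib by linarith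
    qed
    then have "slack_polytope \<subseteq> cbox (\<chi> i. - (2 * real ?d * real ?d)) (\<chi> i :: 'n. 2 * real ?d * real ?d)"
      by (auto simp: mem_box_cart abs_le_iff minus_le_iff)
    then show ?thesis using bounded_cbox bounded_subset by blast
  qed
  ultimately show ?thesis by (simp add: compact_eq_bounded_closed)
qed

text \<open>One inclusion holds because avoiding permutations satisfy the inequalities, the other
  because the polytope is the hull of its vertices and these are block words, which avoid both
  patterns.\<close>

theorem avoidance_polytope_eq_slack_polytope:
  "avoidance_polytope {[1, 3, 2], [2, 1, 3]} = (slack_polytope :: (real ^ 'n::{finite,wellorder}) set)"
proof
  interpret cube_like_polyhedron sum_hyperplane "{1..<CARD('n)}" "\<lambda>k x. top_slack x k" "\<lambda>k x. step_slack x k"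
    "\<lambda>S. vec_of_list (block_word CARD('n) S)" "slack_polytope :: ((real, 'n) vec) set"
    by (rule cube_like_slack_polytope)
  show "avoidance_polytope {[1, 3, 2], [2, 1, 3]} \<subseteq> (slack_polytope :: ((real, 'n) vec) set)"
    unfolding avoidance_polytope_def using avoiding_in_slack_polytope
    by (intro hull_minimal convex_P) auto
  show "slack_polytope \<subseteq> (avoidance_polytope {[1, 3, 2], [2, 1, 3]} :: ((real, 'n) vec) set)"
    unfolding avoidance_polytope_def
    by (subst compact_eq_hull[OF compact_slack_polytope])
      (intro hull_mono image_subsetI imageI block_word_avoiding, rule PowD)
qed

text \<open>Index k stands for position k - 1, so that the index set agrees with that of the slack
  polytope; the last position, d - 1, is the one fixed at 0. The vertex for S has 0 at the positions
  belonging to S and 1 at the others.\<close>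

lemma cube_like_unit_cube:
  "cube_like_polyhedron {x. \<forall>i. CARD('n) \<le> coord_pos i + 1 \<longrightarrow> x $ i = 0} {1..<CARD('n)}
     (\<lambda>k x. coord x (k - 1)) (\<lambda>k x. 1 - coord x (k - 1))
     (\<lambda>S. \<chi> i. if coord_pos i + 1 \<in> {1..<CARD('n)} - S then 1 else 0)
     (unit_cube (CARD('n) - 1) :: (real ^ 'n::{finite,wellorder}) set)"
proof
  show "unit_cube (CARD('n) - 1) = {x \<in> {x :: (real, 'n) vec. \<forall>i. CARD('n) \<le> coord_pos i + 1 \<longrightarrow> x $ i = 0}.
      \<forall>k\<in>{1..<CARD('n)}. 0 \<le> coord x (k - 1) \<and> 0 \<le> 1 - coord x (k - 1)}" (is "_ = ?R")
  proof (intro equalityI subsetI)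
    fix x :: "(real, 'n) vec" assume x: "x \<in> unit_cube (CARD('n) - 1)"
    have "0 \<le> coord x (k - 1) \<and> 0 \<le> 1 - coord x (k - 1)" if "k \<in> {1..<CARD('n)}" for k
    proof -
      have "k - 1 \<in> range (coord_pos :: 'n \<Rightarrow> nat)"
        using that bij_betw_coord_pos[where 'n = 'n] by (auto simp: bij_betw_def)
      then obtain i :: 'n where "k - 1 = coord_pos i" by blast
      then show ?thesis using x that by (auto simp: unit_cube_def split: if_splits)
    qed
    then show "x \<in> ?R" using x by (auto simp: unit_cube_def split: if_splits)
  next
    fix x :: "(real, 'n) vec" assume x: "x \<in> ?R"
    have "0 \<le> x $ i \<and> x $ i \<le> 1" if "coord_pos i < CARD('n) - 1" for i
      using x that by (auto dest!: bspec[of _ _ "coord_pos i + 1"])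
    then show "x \<in> unit_cube (CARD('n) - 1)" using x by (auto simp: unit_cube_def)
  qed
next
  fix S k assume "S \<subseteq> {1..<CARD('n)}"
  have coord: "coord (\<chi> i :: 'n. if coord_pos i + 1 \<in> {1..<CARD('n)} - S then 1 else (0 :: real)) (k - 1)
      = (if k \<in> S then 0 else 1)" if "k \<in> {1..<CARD('n)}" for k
    using that by (subst coord_vec_lambda) auto
  show "coord (\<chi> i :: 'n. if coord_pos i + 1 \<in> {1..<CARD('n)} - S then 1 else (0 :: real)) (k - 1) = 0"
    if "k \<in> S" using coord[of k] that \<open>S \<subseteq> _\<close> by auto
  show "1 - coord (\<chi> i :: 'n. if coord_pos i + 1 \<in> {1..<CARD('n)} - S then 1 else (0 :: real)) (k - 1) = 0"
    if "k \<in> {1..<CARD('n)} - S" using coord[of k] that by auto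
next
  show "1 - coord ((1 - t) *\<^sub>R x + t *\<^sub>R y) (k - 1) = (1 - t) * (1 - coord x (k - 1)) + t * (1 - coord y (k - 1))"
    for k t and x y :: "(real, 'n) vec"
    unfolding coord_affine by (simp add: algebra_simps)
qed (auto simp: affine_alt coord_affine unit_cube_def)

section \<open>Volume in lattice coordinates\<close>

text \<open>
  A body in \<open>\<real>\<^sup>n\<close> whose Lebesgue measure is the volume of \<open>P\<close> in every system of coordinates given
  by a basis of the difference lattice: adding the unit vector \<open>axis i 1\<close> to such a basis gives a
  basis of \<open>\<int>\<^sup>n\<close>, and a unimodular matrix preserves the measure.
\<close>

definition sheared_prism :: "'n \<Rightarrow> (real ^ 'n) set \<Rightarrow> (real ^ 'n) set" where
  "sheared_prism i P = (\<lambda>(q, t). q + t *\<^sub>R axis i 1) ` (P \<times> {0..1})"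

lemma compact_sheared_prism: "compact P \<Longrightarrow> compact (sheared_prism i P)"
  unfolding sheared_prism_def case_prod_beta
  by (intro compact_continuous_image compact_Times continuous_intros) auto

lemma det_Ints:
  fixes A :: "real ^ 'n ^ 'n"
  assumes "\<And>i j. A $ i $ j \<in> \<int>"
  shows "det A \<in> \<int>"
  unfolding det_def using assms by (intro Ints_sum Ints_mult Ints_prod) auto

lemma abs_det_eq_1_if_Ints_inverse:
  fixes A B :: "real ^ 'n ^ 'n"
  assumes "\<And>i j. A $ i $ j \<in> \<int>" "\<And>i j. B $ i $ j \<in> \<int>" "A ** B = mat 1"
  shows "\<bar>det B\<bar> = 1"
proof -
  have "det A * det B = 1" using assms(3) det_mul[of A B] by simp
  moreover obtain a b :: int where "det A = of_int a" "det B = of_int b"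
    using det_Ints assms(1,2) by (metis Ints_cases)
  ultimately have "a * b = 1" by (metis of_int_eq_1_iff of_int_mult)
  then have "\<bar>b\<bar> = 1" by (metis abs_mult abs_one zmult_eq_1_iff mult.commute abs_minus_cancel)
  then show ?thesis using \<open>det B = of_int b\<close> by (metis of_int_abs of_int_1)
qed

lemma measurable_product_to_vec:
  fixes i0 :: "'n::finite" and J :: "'b set"
  assumes h: "bij_betw h (UNIV - {i0}) J"
  shows "(\<lambda>(c, t). \<chi> i :: 'n. if i = i0 then t else (c (h i) :: real))
    \<in> borel_measurable ((\<Pi>\<^sub>M j\<in>J. lborel) \<Otimes>\<^sub>M lborel)" (is "?\<Psi> \<in> borel_measurable ?M")
proof -
  have "(\<lambda>p. ?\<Psi> p $ i) \<in> borel_measurable ?M" for i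
  proof (cases "i = i0")
    case False
    then have "h i \<in> J" using h by (auto simp: bij_betw_def)
    then have "(\<lambda>p. fst p (h i)) \<in> borel_measurable ?M" by measurable
    then show ?thesis using False by (simp add: case_prod_beta)
  qed (simp add: case_prod_beta)
  then show ?thesis
    by (subst borel_measurable_euclidean_space) (auto simp: Basis_vec_def inner_axis)
qed

text \<open>\<open>normalized_volume\<close> measures in a product indexed by lattice vectors. The
  bijection h renames these as the coordinates other than i0, and the extra factor is the direction
  of the prism. Comparing boxes is enough.\<close>

lemma lborel_eq_distr_product:
  fixes i0 :: "'n::finite" and J :: "'b set"
  assumes h: "bij_betw h (UNIV - {i0}) J"
  shows "lborel = distr ((\<Pi>\<^sub>M j\<in>J. lborel) \<Otimes>\<^sub>M lborel) borel
    (\<lambda>(c, t). \<chi> i :: 'n. if i = i0 then t else (c (h i) :: real))"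
proof (rule lborel_eqI)
  let ?M = "(\<Pi>\<^sub>M j\<in>J. lborel :: real measure) \<Otimes>\<^sub>M (lborel :: real measure)"
  let ?\<Psi> = "\<lambda>(c, t). \<chi> i :: 'n. if i = i0 then t else (c (h i) :: real)"
  have finJ: "finite J" using h bij_betw_finite finite by blast
  have hJ: "h i \<in> J" if "i \<noteq> i0" for i using h that by (auto simp: bij_betw_def)
  define g where "g = inv_into (UNIV - {i0}) h"
  have gh: "g (h i) = i" if "i \<noteq> i0" for i using h that by (simp add: g_def bij_betw_def inv_into_f_f)
  have hg: "h (g j) = j" "g j \<noteq> i0" if "j \<in> J" for j
    using h that f_inv_into_f[of j h "UNIV - {i0}"] inv_into_into[of j h "UNIV - {i0}"]
    by (auto simp: g_def bij_betw_def)
  have bg: "bij_betw g J (UNIV - {i0})" unfolding g_def by (rule bij_betw_inv_into[OF h])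
  have [measurable]: "?\<Psi> \<in> borel_measurable ?M" by (rule measurable_product_to_vec[OF h])
  fix l u :: "real ^ 'n" assume lu: "\<And>b. b \<in> Basis \<Longrightarrow> l \<bullet> b \<le> u \<bullet> b"
  have le: "l $ i \<le> u $ i" for i
    using lu[of "axis i 1"] by (simp add: inner_axis axis_in_Basis_iff)
  have "?\<Psi> -` box l u \<inter> space ?M
      = (\<Pi>\<^sub>E j\<in>J. {l $ g j <..< u $ g j}) \<times> {l $ i0 <..< u $ i0}"
  proof (intro equalityI subsetI)
    fix p assume "p \<in> ?\<Psi> -` box l u \<inter> space ?M"
    moreover obtain c t where p: "p = (c, t)" by fastforce
    ultimately have ct: "c \<in> J \<rightarrow>\<^sub>E UNIV" and
      bx: "\<And>i. l $ i < (if i = i0 then t else c (h i)) \<and> (if i = i0 then t else c (h i)) < u $ i"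
      by (auto simp: space_pair_measure space_PiM mem_box_cart)
    have "c j \<in> {l $ g j <..< u $ g j}" if "j \<in> J" for j
      using bx[of "g j"] hg[OF that] by simp
    then show "p \<in> (\<Pi>\<^sub>E j\<in>J. {l $ g j <..< u $ g j}) \<times> {l $ i0 <..< u $ i0}"
      using ct bx[of i0] by (auto simp: p PiE_def)
  next
    fix p assume "p \<in> (\<Pi>\<^sub>E j\<in>J. {l $ g j <..< u $ g j}) \<times> {l $ i0 <..< u $ i0}"
    moreover obtain c t where p: "p = (c, t)" by fastforce
    ultimately have "c \<in> J \<rightarrow>\<^sub>E UNIV" "t \<in> {l $ i0 <..< u $ i0}" "\<And>j. j \<in> J \<Longrightarrow> c j \<in> {l $ g j <..< u $ g j}"
      by (auto simp: PiE_def)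
    then show "p \<in> ?\<Psi> -` box l u \<inter> space ?M"
      using hJ gh by (auto simp: p space_pair_measure space_PiM mem_box_cart) (metis greaterThanLessThan_iff)+
  qed
  then have "emeasure (distr ?M borel ?\<Psi>) (box l u)
      = emeasure (\<Pi>\<^sub>M j\<in>J. lborel) (\<Pi>\<^sub>E j\<in>J. {l $ g j <..< u $ g j}) * ennreal (u $ i0 - l $ i0)"
    using le by (simp add: emeasure_distr lborel.emeasure_pair_measure_Times sets_PiM_I_finite finJ)
  also have "emeasure (\<Pi>\<^sub>M j\<in>J. lborel) (\<Pi>\<^sub>E j\<in>J. {l $ g j <..< u $ g j})
      = (\<Prod>j\<in>J. ennreal (u $ g j - l $ g j))"
    using le by (subst lborel_product.emeasure_PiM[OF finJ]) auto
  also have "\<dots> = (\<Prod>i\<in>UNIV - {i0}. ennreal (u $ i - l $ i))"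
    by (rule prod.reindex_bij_betw[OF bg])
  also have "\<dots> * ennreal (u $ i0 - l $ i0) = (\<Prod>i\<in>UNIV. ennreal (u $ i - l $ i))"
    by (simp add: prod.remove[of UNIV i0] mult.commute)
  also have "\<dots> = ennreal (\<Prod>i\<in>UNIV. u $ i - l $ i)"
    using le by (simp add: prod_ennreal)
  also have "(\<Prod>i\<in>UNIV. u $ i - l $ i) = (\<Prod>b\<in>Basis. (u - l) \<bullet> b)"
  proof -
    have inj: "inj (\<lambda>i :: 'n. axis i (1 :: real))" by (simp add: inj_def axis_eq_axis)
    have Basis: "Basis = range (\<lambda>i :: 'n. axis i (1 :: real))" by (auto simp: Basis_vec_def)
    show ?thesis
      unfolding Basis by (subst prod.reindex[OF inj]) (simp add: inner_axis)
  qed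
  finally show "emeasure (distr ?M borel ?\<Psi>) (box l u) = ennreal (\<Prod>b\<in>Basis. (u - l) \<bullet> b)" .
qed simp

lemma sum_axis: "(\<Sum>k\<in>UNIV. axis i (1 :: real) $ k) = 1"
  by (simp add: axis_def)

lemma axis_integer: "axis i (1 :: real) \<in> integer_points"
  by (auto simp: integer_points_def axis_def)

text \<open>The right-hand side contains neither b nor p, so any two coordinate systems give the
  same measure. The linear map T sends the unit vector at i0 to itself and the other unit vectors to
  the b j; it and its inverse are integral, so it preserves volume.\<close>

proposition measure_lattice_coordinates:
  fixes P :: "(real ^ 'n::{finite,wellorder}) set" and b :: "'j \<Rightarrow> (real, 'n) vec"
  assumes J: "finite J" "card J = CARD('n) - 1"
    and b: "\<And>j. j \<in> J \<Longrightarrow> b j \<in> difference_lattice"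
    and gen: "\<And>z. z \<in> difference_lattice \<Longrightarrow> \<exists>c :: 'j \<Rightarrow> int. z = (\<Sum>j\<in>J. of_int (c j) *\<^sub>R b j)"
    and P: "compact P" "\<And>x. x \<in> P \<Longrightarrow> (\<Sum>i\<in>UNIV. x $ i) = \<sigma>"
    and p: "(\<Sum>i\<in>UNIV. p $ i) = \<sigma>"
  shows "measure (\<Pi>\<^sub>M j\<in>J. lborel) {c \<in> J \<rightarrow>\<^sub>E UNIV. p + (\<Sum>j\<in>J. c j *\<^sub>R b j) \<in> P}
    = measure lborel (sheared_prism i0 P)"
proof -
  let ?e = "axis i0 (1 :: real) :: (real, 'n) vec"
  obtain h where h: "bij_betw h (UNIV - {i0}) J"
    using finite_same_card_bij[of "UNIV - {i0}" J] J by (auto simp: card_Diff_singleton)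
  then have hJ: "h i \<in> J" if "i \<noteq> i0" for i using that by (auto simp: bij_betw_def)
  define T :: "(real, 'n) vec \<Rightarrow> (real, 'n) vec" where
    "T x = x $ i0 *\<^sub>R ?e + (\<Sum>i\<in>UNIV - {i0}. x $ i *\<^sub>R b (h i))" for x
  have lin: "linear T"
    unfolding T_def by (rule linearI) (simp_all add: algebra_simps sum.distrib scaleR_sum_right)
  have T_axis: "T (axis i 1) = (if i = i0 then ?e else b (h i))" for i
  proof (cases "i = i0")
    case True
    then show ?thesis by (simp add: T_def axis_def)
  next
    case False
    then have "(\<Sum>k\<in>UNIV - {i0}. axis i 1 $ k *\<^sub>R b (h k)) = (\<Sum>k\<in>UNIV - {i0}. if k = i then b (h k) else 0)"
      by (intro sum.cong) (auto simp: axis_def)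
    then show ?thesis using False by (simp add: T_def axis_def)
  qed
  define A where "A = matrix T"
  have A: "A *v x = T x" for x unfolding A_def by (metis lin linear_matrix_vector_mul_eq matrix_works)
  have A_int: "A $ i $ j \<in> \<int>" for i j
  proof -
    have "T (axis j 1) \<in> integer_points"
      using b hJ by (auto simp: T_axis axis_integer difference_lattice_def)
    then show ?thesis by (simp add: A_def matrix_def integer_points_def)
  qed
  \<comment> \<open>The inverse is integral: the difference of two unit vectors is an integer
    combination of the b j, and adding the unit vector at i0 shows that every unit vector is the
    image of an integer point.\<close>
  have "\<exists>z. z \<in> integer_points \<and> T z = axis i 1" for i
  proof -
    have "axis i 1 - ?e \<in> difference_lattice"
      using axis_integer[of i] axis_integer[of i0]
      by (simp add: difference_lattice_def integer_points_def sum_subtractf sum_axis)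
    then obtain c :: "'j \<Rightarrow> int" where c: "axis i 1 - ?e = (\<Sum>j\<in>J. of_int (c j) *\<^sub>R b j)"
      using gen by blast
    define z :: "(real, 'n) vec" where "z = (\<chi> k. if k = i0 then 1 else of_int (c (h k)))"
    have "T z = ?e + (\<Sum>k\<in>UNIV - {i0}. of_int (c (h k)) *\<^sub>R b (h k))"
      by (simp add: T_def z_def)
    also have "(\<Sum>k\<in>UNIV - {i0}. of_int (c (h k)) *\<^sub>R b (h k)) = (\<Sum>j\<in>J. of_int (c j) *\<^sub>R b j)"
      by (rule sum.reindex_bij_betw[OF h])
    finally have "T z = axis i 1" by (simp flip: c)
    moreover have "z \<in> integer_points" by (auto simp: z_def integer_points_def)
    ultimately show ?thesis by blast
  qed
  then obtain z where z: "\<And>i. z i \<in> integer_points" "\<And>i. T (z i) = axis i 1" by metis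
  define B :: "((real, 'n) vec, 'n) vec" where "B = (\<chi> r c. z c $ r)"
  have B_int: "B $ i $ j \<in> \<int>" for i j using z(1)[of j] by (simp add: B_def integer_points_def)
  have AB: "A ** B = mat 1"
  proof -
    have "(A ** B) $ r $ c = mat 1 $ r $ c" for r c
    proof -
      have "(A ** B) $ r $ c = (A *v z c) $ r" by (simp add: matrix_matrix_mult_def matrix_vector_mult_def B_def)
      then show ?thesis by (simp add: A z(2) mat_def axis_def)
    qed
    then show ?thesis by (simp add: vec_eq_iff)
  qed
  then have BA: "B ** A = mat 1" using matrix_left_right_inverse by blast
  have detB: "\<bar>det B\<bar> = 1" by (rule abs_det_eq_1_if_Ints_inverse[OF A_int B_int AB])
  have BT: "B *v T x = x" and TB: "T (B *v x) = x" for x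
    unfolding A[symmetric] matrix_vector_mul_assoc AB BA by simp_all
  let ?K = "sheared_prism i0 P"
  \<comment> \<open>The prism in the coordinates given by T and the origin p. There it becomes an
    honest product of the set being measured with a unit interval.\<close>
  define K' where "K' = {x. p + T x \<in> ?K}"
  have K'_eq: "K' = (\<lambda>x. B *v x) ` (+) (- p) ` ?K"
  proof (intro equalityI subsetI)
    fix x assume "x \<in> K'"
    then have "x = B *v (- p + (p + T x))" "p + T x \<in> ?K" by (auto simp: K'_def BT)
    then show "x \<in> (\<lambda>x. B *v x) ` (+) (- p) ` ?K" by blast
  qed (auto simp: K'_def TB)
  have compK: "compact ?K" by (rule compact_sheared_prism[OF P(1)])
  then have comp: "compact ((+) (- p) ` ?K)" by (rule compact_translation)
  have "linear ((\<lambda>x. B *v x))" by (rule matrix_vector_mul_linear)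
  have compK': "compact K'"
    unfolding K'_eq using comp
    by (rule compact_continuous_image[OF linear_continuous_on[OF matrix_vector_mul_bounded_linear]])
  have "measure lebesgue K' = \<bar>det (matrix ((\<lambda>x. B *v x)))\<bar> * measure lebesgue ((+) (- p) ` ?K)"
    unfolding K'_eq using \<open>linear ((\<lambda>x. B *v x))\<close> comp by (intro measure_linear_image lmeasurable_compact)
  then have "measure lebesgue K' = measure lebesgue ?K"
    by (simp add: detB measure_translation_subtract)
  then have meas: "measure lborel K' = measure lborel ?K"
    using compK compK' by (simp add: compact_imp_closed borel_closed)
  define X where "X = {c \<in> J \<rightarrow>\<^sub>E UNIV. p + (\<Sum>j\<in>J. c j *\<^sub>R b j) \<in> P}"
  let ?M = "(\<Pi>\<^sub>M j\<in>J. (lborel :: real measure)) \<Otimes>\<^sub>M (lborel :: real measure)"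
  let ?\<Psi> = "\<lambda>(c, t). \<chi> i :: 'n. if i = i0 then t else (c (h i) :: real)"
  have X_sets: "X \<in> sets (\<Pi>\<^sub>M j\<in>J. lborel)"
  proof -
    have [measurable]: "P \<in> sets borel" using P(1) by (simp add: compact_imp_closed borel_closed)
    have "(\<lambda>c. p + (\<Sum>j\<in>J. c j *\<^sub>R b j)) \<in> borel_measurable (\<Pi>\<^sub>M j\<in>J. lborel)"
      by (intro borel_measurable_add borel_measurable_const borel_measurable_sum borel_measurable_scaleR) auto
    then have "(\<lambda>c. p + (\<Sum>j\<in>J. c j *\<^sub>R b j)) -` P \<inter> space (\<Pi>\<^sub>M j\<in>J. (lborel :: real measure)) \<in> sets (\<Pi>\<^sub>M j\<in>J. lborel)"
      by (rule measurable_sets) measurable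
    also have "(\<lambda>c. p + (\<Sum>j\<in>J. c j *\<^sub>R b j)) -` P \<inter> space (\<Pi>\<^sub>M j\<in>J. (lborel :: real measure)) = X"
      by (auto simp: X_def space_PiM)
    finally show ?thesis .
  qed
  have sum_b: "(\<Sum>k\<in>UNIV. b j $ k) = 0" if "j \<in> J" for j
    using b[OF that] by (simp add: difference_lattice_def)
  have pre: "?\<Psi> -` K' \<inter> space ?M = X \<times> {0..1}"
  proof -
    have iff: "p + T (?\<Psi> (c, t)) \<in> ?K \<longleftrightarrow> 0 \<le> t \<and> t \<le> 1 \<and> p + (\<Sum>j\<in>J. c j *\<^sub>R b j) \<in> P" for c t
    proof -
      let ?s = "p + (\<Sum>j\<in>J. c j *\<^sub>R b j)"
      have "(\<Sum>i\<in>UNIV - {i0}. c (h i) *\<^sub>R b (h i)) = (\<Sum>j\<in>J. c j *\<^sub>R b j)"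
        by (rule sum.reindex_bij_betw[OF h])
      then have eq: "p + T (?\<Psi> (c, t)) = ?s + t *\<^sub>R ?e"
        by (simp add: T_def)
      have sum_s: "(\<Sum>k\<in>UNIV. ?s $ k) = \<sigma>"
      proof -
        have "(\<Sum>k\<in>UNIV. (\<Sum>j\<in>J. c j *\<^sub>R b j) $ k) = (\<Sum>j\<in>J. c j * (\<Sum>k\<in>UNIV. b j $ k))"
          by (simp add: sum_distrib_left) (rule sum.swap)
        then show ?thesis by (simp add: sum.distrib p sum_b)
      qed
      \<comment> \<open>P lies in a hyperplane of constant coordinate sum while the prism direction
        has sum 1, so the coordinate sum determines the height.\<close>
      have "t = t' \<and> ?s = q" if "q \<in> P" "?s + t *\<^sub>R ?e = q + t' *\<^sub>R ?e" for q t'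
      proof -
        have "(\<Sum>k\<in>UNIV. (?s + t *\<^sub>R ?e) $ k) = (\<Sum>k\<in>UNIV. (q + t' *\<^sub>R ?e) $ k)" using that(2) by simp
        then have "\<sigma> + t = \<sigma> + t'"
          using P(2)[OF that(1)] sum_s by (simp add: sum.distrib sum_axis flip: sum_distrib_left)
        then show ?thesis using that(2) by simp
      qed
      then show ?thesis unfolding eq sheared_prism_def by auto
    qed
    show ?thesis
      using iff by (auto simp: K'_def X_def space_pair_measure space_PiM)
  qed
  have "emeasure lborel K' = emeasure (distr ?M borel ?\<Psi>) K'"
    by (simp only: lborel_eq_distr_product[OF h, symmetric])
  also have "\<dots> = emeasure ?M (?\<Psi> -` K' \<inter> space ?M)"
    using compK' measurable_product_to_vec[OF h] by (intro emeasure_distr) (auto simp: compact_imp_closed borel_closed)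
  also have "\<dots> = emeasure (\<Pi>\<^sub>M j\<in>J. lborel) X * emeasure lborel {0..1 :: real}"
    unfolding pre using X_sets by (intro lborel.emeasure_pair_measure_Times) auto
  also have "\<dots> = emeasure (\<Pi>\<^sub>M j\<in>J. lborel) X" by simp
  finally show ?thesis unfolding meas[symmetric] X_def[symmetric] by (simp add: measure_def)
qed

section \<open>Bases of the difference lattice\<close>

lemma integer_combination_in_difference_lattice:
  fixes b :: "'j \<Rightarrow> real ^ 'n"
  assumes "\<And>j. j \<in> J \<Longrightarrow> b j \<in> difference_lattice"
  shows "(\<Sum>j\<in>J. of_int (c j) *\<^sub>R b j) \<in> difference_lattice"
proof -
  have "(\<Sum>k\<in>UNIV. (\<Sum>j\<in>J. of_int (c j) *\<^sub>R b j) $ k) = (\<Sum>j\<in>J. of_int (c j) * (\<Sum>k\<in>UNIV. b j $ k))"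
    by (simp add: sum_distrib_left) (rule sum.swap)
  moreover have "(\<Sum>j\<in>J. of_int (c j) *\<^sub>R b j) $ k \<in> \<int>" for k
    using assms by (auto simp: difference_lattice_def integer_points_def intro!: Ints_sum)
  ultimately show ?thesis
    using assms by (simp add: difference_lattice_def integer_points_def)
qed

lemma axis_difference_combination:
  fixes z :: "real ^ 'n"
  assumes "(\<Sum>i\<in>UNIV. z $ i) = 0"
  shows "z = (\<Sum>i\<in>UNIV - {i0}. z $ i *\<^sub>R (axis i 1 - axis i0 1))"
proof -
  have z0: "z $ i0 = - (\<Sum>i\<in>UNIV - {i0}. z $ i)"
    using assms by (simp add: sum.remove[of UNIV i0])
  have "z $ k = (\<Sum>i\<in>UNIV - {i0}. z $ i *\<^sub>R (axis i 1 - axis i0 1)) $ k" for k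
  proof (cases "k = i0")
    case True
    then show ?thesis using z0
      by (simp add: axis_def sum_negf[symmetric] del: sum_negf)
  next
    case False
    then have "(\<Sum>i\<in>UNIV - {i0}. z $ i *\<^sub>R (axis i 1 - axis i0 1)) $ k = (\<Sum>i\<in>UNIV - {i0}. z $ i * (if k = i then 1 else 0))"
      by (simp add: axis_def)
    also have "\<dots> = z $ k"
      using False by (subst sum.remove[of _ k]) (auto intro!: sum.neutral)
    finally show ?thesis by simp
  qed
  then show ?thesis unfolding vec_eq_iff by blast
qed

lemma axis_difference_in_lattice: "axis i 1 - axis i0 1 \<in> difference_lattice"
  using axis_integer[of i] axis_integer[of i0]
  by (simp add: difference_lattice_def integer_points_def sum_subtractf sum_axis)

lemma span_insert_axis_UNIV:
  fixes B :: "(real ^ 'n) set"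
  assumes "\<And>i. axis i 1 - axis i0 1 \<in> span B"
  shows "span (insert (axis i0 1) B) = UNIV"
proof -
  have "axis i 1 \<in> span (insert (axis i0 1) B)" for i
  proof -
    have "axis i 1 - axis i0 1 \<in> span (insert (axis i0 1) B)"
      using assms span_mono[of B "insert (axis i0 1) B"] by blast
    moreover have "axis i0 1 \<in> span (insert (axis i0 1) B)" by (simp add: span_base)
    ultimately have "(axis i 1 - axis i0 1) + axis i0 1 \<in> span (insert (axis i0 1) B)" by (rule span_add)
    then show ?thesis by simp
  qed
  then have "Basis \<subseteq> span (insert (axis i0 1) B)" by (auto simp: Basis_vec_def)
  then show ?thesis by (metis span_Basis span_minimal subspace_span top.extremum_uniqueI)
qed

text \<open>The differences of the unit vectors with a fixed one. Independence comes from counting: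
  completed by the fixed unit vector, they are at most d vectors that span the space. The lemma
  gives the choice of basis in \<open>normalized_volume\<close> its meaning.\<close>

lemma lattice_basis_exists: "\<exists>B. lattice_basis B (difference_lattice :: (real ^ 'n) set)"
proof -
  obtain i0 :: 'n where True by simp
  define b :: "'n \<Rightarrow> real ^ 'n" where "b i = axis i 1 - axis i0 1" for i
  define B where "B = b ` (UNIV - {i0})"
  have inj: "inj_on b (UNIV - {i0})" by (auto simp: inj_on_def b_def axis_eq_axis)
  have "b i \<in> span B" for i
    by (cases "i = i0") (auto simp: b_def[of i0] span_zero B_def intro: span_base)
  then have "span (insert (axis i0 1) B) = UNIV" by (intro span_insert_axis_UNIV) (simp add: b_def)
  moreover have "card (insert (axis i0 1) B) \<le> CARD('n)"
  proof -
    have "card (insert (axis i0 1) B) \<le> Suc (card B)" by (rule card_insert_le_m1) auto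
    also have "card B \<le> CARD('n) - 1" unfolding B_def using card_image_le[of "UNIV - {i0}" b] by simp
    finally show ?thesis by (simp add: Suc_diff_1)
  qed
  ultimately have "independent (insert (axis i0 1) B)"
    by (intro card_le_dim_spanning[of _ UNIV]) (auto simp: B_def dim_UNIV)
  then have "independent B" using independent_mono by blast
  moreover have "finite B" by (simp add: B_def)
  moreover have "difference_lattice = range (\<lambda>c :: real ^ 'n \<Rightarrow> int. \<Sum>b\<in>B. of_int (c b) *\<^sub>R b)"
  proof (intro equalityI subsetI)
    fix z :: "real ^ 'n" assume z: "z \<in> difference_lattice"
    then have int: "of_int \<lfloor>z $ i\<rfloor> = z $ i" for i by (simp add: difference_lattice_def integer_points_def)
    have "z = (\<Sum>i\<in>UNIV - {i0}. z $ i *\<^sub>R b i)"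
      unfolding b_def using z by (intro axis_difference_combination) (simp add: difference_lattice_def)
    also have "\<dots> = (\<Sum>x\<in>B. of_int \<lfloor>z $ inv_into (UNIV - {i0}) b x\<rfloor> *\<^sub>R x)"
      unfolding B_def by (simp add: sum.reindex[OF inj] int inv_into_f_f[OF inj])
    finally show "z \<in> range (\<lambda>c :: real ^ 'n \<Rightarrow> int. \<Sum>b\<in>B. of_int (c b) *\<^sub>R b)"
      by (rule range_eqI[where x = "\<lambda>x. \<lfloor>z $ inv_into (UNIV - {i0}) b x\<rfloor>"])
  next
    fix z :: "real ^ 'n" assume "z \<in> range (\<lambda>c :: real ^ 'n \<Rightarrow> int. \<Sum>b\<in>B. of_int (c b) *\<^sub>R b)"
    then obtain c :: "real ^ 'n \<Rightarrow> int" where "z = (\<Sum>b\<in>B. of_int (c b) *\<^sub>R b)" by blast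
    moreover have "x \<in> difference_lattice" if "x \<in> B" for x
      using that axis_difference_in_lattice by (auto simp: B_def b_def)
    ultimately show "z \<in> difference_lattice"
      using integer_combination_in_difference_lattice[of B "\<lambda>x. x" c] by simp
  qed
  ultimately show ?thesis unfolding lattice_basis_def by blast
qed

text \<open>For the cardinality, a unit vector has coordinate sum 1 and so lies outside the span of
  B; added to B it completes a basis of the whole space.\<close>

lemma lattice_basis_properties:
  fixes B :: "(real ^ 'n) set"
  assumes B: "lattice_basis B difference_lattice"
  shows "finite B" "B \<subseteq> difference_lattice" "card B = CARD('n) - 1"
    "\<And>z. z \<in> difference_lattice \<Longrightarrow> \<exists>c :: real ^ 'n \<Rightarrow> int. z = (\<Sum>b\<in>B. of_int (c b) *\<^sub>R b)"
proof -
  have fin: "finite B" and ind: "independent B"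
    and L: "difference_lattice = range (\<lambda>c :: real ^ 'n \<Rightarrow> int. \<Sum>b\<in>B. of_int (c b) *\<^sub>R b)"
    using B by (auto simp: lattice_basis_def)
  show "finite B" by (rule fin)
  show gen: "\<exists>c :: real ^ 'n \<Rightarrow> int. z = (\<Sum>b\<in>B. of_int (c b) *\<^sub>R b)" if "z \<in> difference_lattice" for z
    using that unfolding L by blast
  show sub: "B \<subseteq> difference_lattice"
  proof
    fix x assume "x \<in> B"
    have "(\<Sum>b\<in>B. of_int (if b = x then 1 else 0) *\<^sub>R b) = (\<Sum>b\<in>B. if b = x then b else 0)"
      by (intro sum.cong) auto
    also have "\<dots> = x" using fin \<open>x \<in> B\<close> by simp
    finally have *: "(\<Sum>b\<in>B. of_int (if b = x then 1 else 0) *\<^sub>R b) = x" .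
    show "x \<in> difference_lattice"
      unfolding L by (rule range_eqI[where x = "\<lambda>b. if b = x then 1 else 0"]) (rule *[symmetric])
  qed
  obtain i0 :: 'n where True by simp
  have "axis i 1 - axis i0 1 \<in> span B" for i
  proof -
    obtain c :: "real ^ 'n \<Rightarrow> int" where "axis i 1 - axis i0 1 = (\<Sum>b\<in>B. of_int (c b) *\<^sub>R b)"
      using gen[OF axis_difference_in_lattice] by blast
    then show ?thesis by (simp add: span_sum span_scale span_base)
  qed
  then have span: "span (insert (axis i0 1) B) = UNIV" by (rule span_insert_axis_UNIV)
  have sub0: "subspace {x :: real ^ 'n. (\<Sum>i\<in>UNIV. x $ i) = 0}"
    by (rule subspaceI) (auto simp: sum.distrib simp flip: sum_distrib_left)
  have "span B \<subseteq> {x. (\<Sum>i\<in>UNIV. x $ i) = 0}"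
    using sub by (intro span_minimal sub0) (auto simp: difference_lattice_def)
  then have notin: "axis i0 1 \<notin> span B" using sum_axis[of i0] by auto
  then have "independent (insert (axis i0 1) B)" using ind by (simp add: independent_insert)
  then have "card (insert (axis i0 1) B) = dim (UNIV :: (real ^ 'n) set)"
    using span by (intro dim_eq_card[symmetric]) auto
  moreover have "axis i0 1 \<notin> B" using notin span_base by blast
  ultimately show "card B = CARD('n) - 1" using fin by (simp add: dim_UNIV)
qed

text \<open>The lattice basis dual to the functions \<^term>\<open>\<lambda>x. top_slack x k\<close>.\<close>

definition cut_vector :: "nat \<Rightarrow> real ^ 'n::{finite,wellorder}" where
  "cut_vector k = (\<chi> i. (if coord_pos i = k then 1 else 0) - (if coord_pos i + 1 = k then 1 else 0))"

lemma coord_cut_vector: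
  "m < CARD('n) \<Longrightarrow> coord (cut_vector k :: real ^ 'n::{finite,wellorder}) m
    = (if m = k then 1 else 0) - (if m + 1 = k then 1 else 0)"
  unfolding cut_vector_def
  using coord_vec_lambda[of m "\<lambda>m. (if m = k then 1 else 0) - (if m + 1 = k then 1 else (0 :: real))", where 'n = 'n]
  by simp

lemma coord_sum_cut_vector:
  assumes "m < CARD('n)"
  shows "coord (\<Sum>k\<in>{0<..<CARD('n)}. y k *\<^sub>R (cut_vector k :: real ^ 'n::{finite,wellorder})) m
    = zero_ext 0 CARD('n) y m - zero_ext 0 CARD('n) y (m + 1)"
proof -
  have "coord (\<Sum>k\<in>{0<..<CARD('n)}. y k *\<^sub>R (cut_vector k :: (real, 'n) vec)) m
      = (\<Sum>k\<in>{0<..<CARD('n)}. y k * coord (cut_vector k :: (real, 'n) vec) m)"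
    by (simp add: coord_def)
  also have "\<dots> = (\<Sum>k\<in>{0<..<CARD('n)}. (if k = m then y k else 0) - (if k = m + 1 then y k else 0))"
    by (intro sum.cong refl) (simp add: coord_cut_vector[OF assms])
  also have "\<dots> = (\<Sum>k\<in>{0<..<CARD('n)}. if k = m then y k else 0)
      - (\<Sum>k\<in>{0<..<CARD('n)}. if k = m + 1 then y k else 0)"
    by (rule sum_subtractf)
  also have "\<dots> = zero_ext 0 CARD('n) y m - zero_ext 0 CARD('n) y (m + 1)"
    unfolding zero_ext_def by (simp only: sum.delta finite_greaterThanLessThan greaterThanLessThan_iff)
  finally show ?thesis .
qed

lemma vec_eq_coordI:
  fixes x y :: "'a ^ 'n::{finite,wellorder}"
  assumes "\<And>m. m < CARD('n) \<Longrightarrow> coord x m = coord y m"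
  shows "x = y"
proof -
  have "x $ i = y $ i" for i
    using assms[OF coord_pos_less_CARD[of i]] by simp
  then show ?thesis unfolding vec_eq_iff by blast
qed

lemma sum_telescope_neg:
  fixes z :: "nat \<Rightarrow> real"
  shows "(\<Sum>m<k. z m - z (m + 1)) = z 0 - z k"
  by (induction k) auto

lemma cut_vector_in_lattice:
  assumes "k \<in> {0<..<CARD('n)}"
  shows "(cut_vector k :: real ^ 'n::{finite,wellorder}) \<in> difference_lattice"
proof -
  let ?y = "\<lambda>j. if j = k then 1 else 0 :: real"
  have "(\<Sum>j\<in>{0<..<CARD('n)}. ?y j *\<^sub>R (cut_vector j :: (real, 'n) vec))
      = (\<Sum>j\<in>{0<..<CARD('n)}. if j = k then cut_vector j else 0)"
    by (intro sum.cong) auto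
  also have "\<dots> = cut_vector k" using assms by simp
  finally have "(\<Sum>i\<in>UNIV. (cut_vector k :: (real, 'n) vec) $ i)
      = (\<Sum>m<CARD('n). coord (\<Sum>j\<in>{0<..<CARD('n)}. ?y j *\<^sub>R (cut_vector j :: (real, 'n) vec)) m)"
    by (simp only: sum_coords)
  also have "\<dots> = (\<Sum>m<CARD('n). zero_ext 0 CARD('n) ?y m - zero_ext 0 CARD('n) ?y (m + 1))"
    by (intro sum.cong refl coord_sum_cut_vector) simp
  also have "\<dots> = 0" unfolding sum_telescope_neg by (simp add: zero_ext_def)
  finally show ?thesis by (auto simp: difference_lattice_def integer_points_def cut_vector_def)
qed

lemma cut_vectors_generate:
  fixes z :: "real ^ 'n::{finite,wellorder}"
  assumes "z \<in> difference_lattice"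
  shows "\<exists>c :: nat \<Rightarrow> int. z = (\<Sum>k\<in>{0<..<CARD('n)}. of_int (c k) *\<^sub>R cut_vector k)"
proof -
  \<comment> \<open>The coefficient of \<open>cut_vector k\<close> is the linear part of
    \<open>top_slack\<close> at k. It is integral and vanishes at 0 and at d, so its successive
    differences recover z.\<close>
  define s where "s k = - (\<Sum>m<k. coord z m)" for k
  have "coord z m \<in> \<int>" for m
    using assms by (simp add: coord_def difference_lattice_def integer_points_def)
  then have "s k \<in> \<int>" for k unfolding s_def by (intro Ints_minus Ints_sum)
  then have s_int: "of_int \<lfloor>s k\<rfloor> = s k" for k by (metis Ints_cases floor_of_int)
  have "s CARD('n) = 0" using assms by (simp add: s_def difference_lattice_def sum_coords)
  moreover have "s 0 = 0" by (simp add: s_def)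
  ultimately have ext: "zero_ext 0 CARD('n) s m = s m" if "m \<le> CARD('n)" for m
    using that by (cases "m = 0"; cases "m = CARD('n)") (auto simp: zero_ext_def)
  have "z = (\<Sum>k\<in>{0<..<CARD('n)}. s k *\<^sub>R cut_vector k)"
  proof (rule vec_eq_coordI)
    fix m assume m: "m < CARD('n)"
    have "coord (\<Sum>k\<in>{0<..<CARD('n)}. s k *\<^sub>R (cut_vector k :: (real, 'n) vec)) m = s m - s (m + 1)"
      unfolding coord_sum_cut_vector[OF m] using m ext[of m] ext[of "m + 1"] by simp
    moreover have "s m - s (m + 1) = coord z m" by (simp add: s_def)
    ultimately show "coord z m = coord (\<Sum>k\<in>{0<..<CARD('n)}. s k *\<^sub>R (cut_vector k :: (real, 'n) vec)) m"
      by simp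
  qed
  then have "z = (\<Sum>k\<in>{0<..<CARD('n)}. of_int \<lfloor>s k\<rfloor> *\<^sub>R cut_vector k)" by (simp only: s_int)
  then show ?thesis by (intro exI[of _ "\<lambda>k. \<lfloor>s k\<rfloor>"])
qed

text \<open>The decreasing word d, d-1, ..., 1, at which all top slacks vanish: the origin of the
  coordinates y.\<close>

definition top_point :: "real ^ 'n::{finite,wellorder}" where
  "top_point = (\<chi> i. real CARD('n) - real (coord_pos i))"

text \<open>Each coordinate is that of \<open>top_point\<close> plus a difference of successive y,
  so the partial sums telescope.\<close>

lemma top_slack_cut_vector_combination:
  assumes "k \<le> CARD('n)"
  shows "top_slack (top_point + (\<Sum>k\<in>{0<..<CARD('n)}. y k *\<^sub>R (cut_vector k :: real ^ 'n::{finite,wellorder}))) k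
    = zero_ext 0 CARD('n) y k"
  using assms
proof (induction k)
  case 0
  then show ?case by (simp add: top_slack_0 zero_ext_def)
next
  case (Suc k)
  have "coord (top_point + (\<Sum>k\<in>{0<..<CARD('n)}. y k *\<^sub>R (cut_vector k :: (real, 'n) vec))) k
      = coord (top_point :: (real, 'n) vec) k + coord (\<Sum>k\<in>{0<..<CARD('n)}. y k *\<^sub>R (cut_vector k :: (real, 'n) vec)) k"
    by (simp add: coord_def)
  also have "coord (top_point :: (real, 'n) vec) k = real CARD('n) - real k"
    unfolding top_point_def using Suc.prems by (intro coord_vec_lambda) simp
  also have "coord (\<Sum>k\<in>{0<..<CARD('n)}. y k *\<^sub>R (cut_vector k :: (real, 'n) vec)) k
      = zero_ext 0 CARD('n) y k - zero_ext 0 CARD('n) y (k + 1)"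
    using Suc.prems by (intro coord_sum_cut_vector) simp
  finally show ?case using Suc by (simp add: top_slack_Suc)
qed

lemma cut_vector_combination_in_slack_polytope_iff:
  assumes "y \<in> {0<..<CARD('n)} \<rightarrow>\<^sub>E UNIV"
  shows "top_point + (\<Sum>k\<in>{0<..<CARD('n)}. y k *\<^sub>R (cut_vector k :: real ^ 'n::{finite,wellorder})) \<in> slack_polytope
    \<longleftrightarrow> y \<in> dual_cell 0 CARD('n)"
proof -
  define x :: "(real, 'n) vec" where
    "x = top_point + (\<Sum>k\<in>{0<..<CARD('n)}. y k *\<^sub>R (cut_vector k :: (real, 'n) vec))"
  define Y where "Y = zero_ext 0 CARD('n) y"
  have top: "top_slack x k = Y k" if "k \<le> CARD('n)" for k
    unfolding x_def Y_def by (rule top_slack_cut_vector_combination[OF that])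
  have "x \<in> slack_polytope \<longleftrightarrow> (\<forall>k\<in>{1..<CARD('n)}. 0 \<le> top_slack x k \<and> 0 \<le> step_slack x k)"
    by (simp add: slack_polytope_def sum_hyperplane_def top) (simp add: Y_def zero_ext_def)
  also have "\<dots> \<longleftrightarrow> cell_ineqs 0 CARD('n) Y"
  proof -
    have "0 \<le> step_slack x k \<longleftrightarrow> 2 * Y k \<le> 2 + Y (k - 1) + Y (k + 1)" if "k \<in> {1..<CARD('n)}" for k
    proof -
      have "0 < k" "k \<le> CARD('n)" "k - 1 \<le> CARD('n)" "k + 1 \<le> CARD('n)" using that by auto
      then show ?thesis by (auto simp only: step_slack_eq_second_difference top)
    qed
    then show ?thesis unfolding cell_ineqs_def by (auto simp: top Suc_le_eq)
  qed
  finally show ?thesis using assms by (simp add: x_def Y_def dual_cell_def)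
qed

lemma sum_hyperplane_coordinate_sum:
  "x \<in> sum_hyperplane \<longleftrightarrow> (\<Sum>i\<in>UNIV. x $ i) = real CARD('n) * (real CARD('n) + 1) / 2"
  for x :: "real ^ 'n::{finite,wellorder}"
  by (simp add: sum_hyperplane_def top_slack_def sum_coords field_simps) auto

theorem normalized_volume_slack_polytope:
  "normalized_volume difference_lattice (slack_polytope :: (real ^ 'n::{finite,wellorder}) set)
    = fact (CARD('n) - 1) * cell_volume CARD('n)"
proof -
  let ?P = "slack_polytope :: (real, 'n) vec set"
  let ?\<sigma> = "real CARD('n) * (real CARD('n) + 1) / 2"
  have sum_P: "(\<Sum>i\<in>UNIV. x $ i) = ?\<sigma>" if "x \<in> ?P" for x
    using that sum_hyperplane_coordinate_sum[of x] by (auto simp: slack_polytope_def)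
  obtain i0 :: 'n where True by simp
  define B where "B = (SOME B. lattice_basis B (difference_lattice :: (real, 'n) vec set))"
  define p where "p = (SOME p. p \<in> ?P)"
  have "?P \<noteq> {}" using avoiding_in_slack_polytope[OF block_word_avoiding[of "{}"]] by blast
  then have "p \<in> ?P" unfolding p_def by (simp add: some_in_eq)
  have "lattice_basis B (difference_lattice :: (real, 'n) vec set)"
    unfolding B_def using lattice_basis_exists by (rule someI_ex)
  note B = lattice_basis_properties[OF this]
  \<comment> \<open>The unknown basis and origin are exchanged for the cut vectors and
    \<open>top_point\<close> by way of the common prism; the choice of i0 is arbitrary.\<close>
  have "measure (\<Pi>\<^sub>M b\<in>B. lborel) {c \<in> B \<rightarrow>\<^sub>E UNIV. p + (\<Sum>b\<in>B. c b *\<^sub>R b) \<in> ?P}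
      = measure lborel (sheared_prism i0 ?P)"
    using B sum_P \<open>p \<in> ?P\<close> compact_slack_polytope
    by (intro measure_lattice_coordinates[where \<sigma> = ?\<sigma>]) auto
  also have "\<dots> = measure (\<Pi>\<^sub>M k\<in>{0<..<CARD('n)}. lborel)
      {y \<in> {0<..<CARD('n)} \<rightarrow>\<^sub>E UNIV. top_point + (\<Sum>k\<in>{0<..<CARD('n)}. y k *\<^sub>R cut_vector k) \<in> ?P}"
  proof (rule measure_lattice_coordinates[where \<sigma> = ?\<sigma>, symmetric])
    have "top_slack (top_point :: (real, 'n) vec) CARD('n) = 0"
      using top_slack_cut_vector_combination[where 'n = 'n, of "CARD('n)" "\<lambda>_. 0"] by (simp add: zero_ext_def)
    then show "(\<Sum>i\<in>UNIV. (top_point :: (real, 'n) vec) $ i) = ?\<sigma>"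
      by (intro sum_hyperplane_coordinate_sum[THEN iffD1]) (simp add: sum_hyperplane_def)
  qed (use compact_slack_polytope cut_vector_in_lattice cut_vectors_generate sum_P in auto)
  also have "{y \<in> {0<..<CARD('n)} \<rightarrow>\<^sub>E UNIV. top_point + (\<Sum>k\<in>{0<..<CARD('n)}. y k *\<^sub>R cut_vector k) \<in> ?P}
      = dual_cell 0 CARD('n)"
    using cut_vector_combination_in_slack_polytope_iff[where 'n = 'n] by (auto simp: dual_cell_def)
  also have "measure (\<Pi>\<^sub>M k\<in>{0<..<CARD('n)}. lborel) (dual_cell 0 CARD('n)) = cell_volume CARD('n)"
    using emeasure_dual_cell[of 0 "CARD('n)"] by (simp add: measure_def cell_volume_def)
  finally show ?thesis
    unfolding normalized_volume_def Let_def B_def[symmetric] p_def[symmetric] B(3) by simp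
qed

text \<open>The quotient of factorials leaves one factor d in the denominator and
  \<open>cell_volume\<close> contributes another, so d^(d-1) is divided by d^2. The exponent d - 3
  is negative for d = 1 and d = 2, hence \<open>powi\<close>.\<close>

lemma fact_times_cell_volume:
  assumes "d \<ge> 1"
  shows "fact (d - 1) * cell_volume d = 2 ^ (d - 1) * real d powi (int d - 3)"
proof -
  obtain m where d: "d = Suc m" using assms by (cases d) auto
  have fact: "fact d = real d * fact m" and "d - 1 = m" and "real d \<noteq> 0" by (simp_all add: d)
  then have "fact (d - 1) * cell_volume d = 2 ^ m * (real d ^ m / real d ^ 2)"
    by (simp add: cell_volume_def power2_eq_square)
  also have "real d ^ m / real d ^ 2 = real d powi (int d - 3)"
  proof -
    have "real d powi (int d - 3) = real d powi (int m - int 2)" by (simp add: d)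
    also have "\<dots> = real d ^ m / real d ^ 2"
      using \<open>real d \<noteq> 0\<close> by (subst power_int_diff) (auto simp: power_int_of_nat)
    finally show ?thesis by simp
  qed
  finally show ?thesis using \<open>d - 1 = m\<close> by simp
qed

section \<open>Lattice equivalence\<close>

definition flip :: "real ^ 'n::{finite,wellorder} \<Rightarrow> (real, 'n) vec" where
  "flip x = (\<chi> i. real CARD('n) + real (coord_pos i)) - x"

lemma flip_flip [simp]: "flip (flip x) = x"
  by (simp add: flip_def)

lemma coord_flip:
  "k < CARD('n) \<Longrightarrow> coord (flip x) k = real CARD('n) + real k - coord x k"
  for x :: "real ^ 'n::{finite,wellorder}"
  using coord_vec_lambda[of k "\<lambda>k. real CARD('n) + real k", where 'n = 'n]
  by (simp add: flip_def coord_def)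

text \<open>The sums of d + j and of d - j over j < k differ by k (k - 1), twice the binomial
  coefficient; this is where the dilation factor 2 of the chain permutahedron originates.\<close>

lemma sum_coord_flip:
  fixes x :: "real ^ 'n::{finite,wellorder}"
  assumes "k \<le> CARD('n)"
  shows "(\<Sum>j<k. coord (flip x) j) = top_slack x k + 2 * real (k choose 2)"
  using assms
proof (induction k)
  case 0
  then show ?case by (simp add: top_slack_0)
next
  case (Suc k)
  have "real (Suc k choose 2) = real k + real (k choose 2)" by (simp add: numeral_2_eq_2)
  then show ?case using Suc by (simp add: top_slack_Suc coord_flip)
qed

lemma coord_mono_iff:
  fixes a :: "real ^ 'n::{finite,wellorder}"
  shows "(\<forall>i j. i \<le> j \<longrightarrow> a $ i \<le> a $ j) \<longleftrightarrow> (\<forall>k\<in>{1..<CARD('n)}. coord a (k - 1) \<le> coord a k)"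
proof (intro iffI ballI allI impI)
  fix k assume mono: "\<forall>i j. i \<le> j \<longrightarrow> a $ i \<le> a $ j" and k: "k \<in> {1..<CARD('n)}"
  have "k - 1 \<in> coord_pos ` (UNIV :: 'n set)" "k \<in> coord_pos ` (UNIV :: 'n set)"
    using k bij_betw_coord_pos[where 'n = 'n] by (auto simp: bij_betw_def)
  then obtain i j :: 'n where ij: "k - 1 = coord_pos i" "k = coord_pos j" by blast
  then have "i \<le> j" using k by (simp flip: coord_pos_le_iff)
  then show "coord a (k - 1) \<le> coord a k" using mono unfolding ij(1) by (simp add: ij(2))
next
  fix i j :: 'n assume step: "\<forall>k\<in>{1..<CARD('n)}. coord a (k - 1) \<le> coord a k" and "i \<le> j"
  have "coord a l \<le> coord a m" if "l \<le> m" "m < CARD('n)" for l m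
    using that
  proof (induction m rule: dec_induct)
    case (step m)
    then show ?case using \<open>\<forall>k\<in>_. _\<close>[rule_format, of "Suc m"] by simp
  qed simp
  from this[of "coord_pos i" "coord_pos j"] \<open>i \<le> j\<close> show "a $ i \<le> a $ j"
    by (simp add: coord_pos_le_iff coord_pos_less_CARD)
qed

lemma twice_chain_permutahedron_iff:
  fixes a :: "real ^ 'n::{finite,wellorder}"
  shows "a \<in> (\<lambda>a. 2 *\<^sub>R a) ` translated_chain_permutahedron \<longleftrightarrow>
    (\<forall>k\<in>{1..<CARD('n)}. coord a (k - 1) \<le> coord a k) \<and> (\<Sum>j<CARD('n). coord a j) = 2 * real (CARD('n) choose 2) \<and>
    (\<forall>k\<in>{1..<CARD('n)}. 2 * real (k choose 2) \<le> (\<Sum>j<k. coord a j))"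
proof -
  have "a \<in> (\<lambda>a. 2 *\<^sub>R a) ` translated_chain_permutahedron \<longleftrightarrow> (1 / 2) *\<^sub>R a \<in> translated_chain_permutahedron"
    by (force simp: image_iff)
  also have "\<dots> \<longleftrightarrow> (\<forall>i j. i \<le> j \<longrightarrow> a $ i \<le> a $ j) \<and> (\<Sum>i\<in>UNIV. a $ i) = 2 * real (CARD('n) choose 2) \<and>
      (\<forall>k. 1 \<le> k \<and> k < CARD('n) \<longrightarrow> 2 * real (k choose 2) \<le> (\<Sum>i | coord_pos i < k. a $ i))"
  proof -
    have half: "(\<Sum>i\<in>A. ((1 / 2) *\<^sub>R a) $ i) = (\<Sum>i\<in>A. a $ i) / 2" for A by (simp add: sum_divide_distrib)
    show ?thesis
      unfolding translated_chain_permutahedron_def mem_Collect_eq half by (simp add: field_simps)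
  qed
  also have "(\<forall>k. 1 \<le> k \<and> k < CARD('n) \<longrightarrow> 2 * real (k choose 2) \<le> (\<Sum>i | coord_pos i < k. a $ i))
      \<longleftrightarrow> (\<forall>k\<in>{1..<CARD('n)}. 2 * real (k choose 2) \<le> (\<Sum>j<k. coord a j))"
    by (auto simp: sum_coord_pos_less)
  finally show ?thesis by (simp only: coord_mono_iff sum_coords)
qed

lemma flip_in_twice_chain_permutahedron_iff:
  "flip x \<in> (\<lambda>a. 2 *\<^sub>R a) ` translated_chain_permutahedron \<longleftrightarrow> x \<in> slack_polytope"
  for x :: "real ^ 'n::{finite,wellorder}"
proof -
  have "coord (flip x) (k - 1) \<le> coord (flip x) k \<longleftrightarrow> 0 \<le> step_slack x k"
    "2 * real (k choose 2) \<le> (\<Sum>j<k. coord (flip x) j) \<longleftrightarrow> 0 \<le> top_slack x k"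
    if "k \<in> {1..<CARD('n)}" for k
    using that by (auto simp: sum_coord_flip) (auto simp: coord_flip step_slack_def)
  then show ?thesis
    unfolding twice_chain_permutahedron_iff slack_polytope_def sum_hyperplane_def
    by (auto simp: sum_coord_flip)
qed

lemma flip_slack_polytope:
  "flip ` slack_polytope = (\<lambda>a. 2 *\<^sub>R a) ` (translated_chain_permutahedron :: (real ^ 'n::{finite,wellorder}) set)"
proof (intro equalityI subsetI)
  fix a :: "(real, 'n) vec" assume "a \<in> (\<lambda>a. 2 *\<^sub>R a) ` translated_chain_permutahedron"
  then have "flip a \<in> slack_polytope" using flip_in_twice_chain_permutahedron_iff[of "flip a"] by simp
  then show "a \<in> flip ` slack_polytope" by (metis flip_flip imageI)
qed (auto simp: flip_in_twice_chain_permutahedron_iff)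

lemma flip_integer_points_iff: "flip x \<in> integer_points \<longleftrightarrow> x \<in> integer_points"
proof -
  have "flip x \<in> integer_points" if "x \<in> integer_points" for x :: "real ^ 'a::{finite,wellorder}"
    using that by (simp add: flip_def integer_points_def)
  then show ?thesis by (metis flip_flip)
qed

lemma flip_affine_hull:
  fixes P :: "(real ^ 'n::{finite,wellorder}) set"
  shows "flip ` (affine hull P) = affine hull (flip ` P)"
proof -
  define c :: "(real, 'n) vec" where "c = (\<chi> i. real CARD('n) + real (coord_pos i))"
  have flip_eq: "flip = (\<lambda>x. c + x) \<circ> (\<lambda>x. - x)" by (auto simp: flip_def c_def fun_eq_iff)
  have "(\<lambda>x. - x) ` (affine hull P) = affine hull ((\<lambda>x. - x) ` P)"
    by (rule affine_hull_linear_image) (rule bounded_linear_minus[OF bounded_linear_ident])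
  then show ?thesis unfolding flip_eq image_comp[symmetric] affine_hull_translation by simp
qed

text \<open>\<open>flip\<close> is an affine involution of the whole space that preserves the
  integer points, so its restriction to any affine hull is a lattice equivalence onto the
  image.\<close>

lemma lattice_equivalent_flip: "lattice_equivalent P (flip ` P)"
proof -
  have inj: "inj flip" by (metis flip_flip injI)
  show ?thesis
    unfolding lattice_equivalent_def
  proof (intro exI[of _ flip] conjI)
    show "affine_map_on (affine hull P) flip"
      unfolding affine_map_on_def flip_def by (simp add: vec_eq_iff algebra_simps)
    show "bij_betw flip (affine hull P) (affine hull flip ` P)"
      unfolding bij_betw_def flip_affine_hull[symmetric] using inj by (auto intro: inj_on_subset)
    have "flip ` (affine hull P \<inter> integer_points) = flip ` (affine hull P) \<inter> integer_points"
      by (auto simp: flip_integer_points_iff)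
    then show "bij_betw flip (affine hull P \<inter> integer_points) (affine hull flip ` P \<inter> integer_points)"
      unfolding bij_betw_def flip_affine_hull[symmetric] using inj by (auto intro: inj_on_subset)
  qed simp
qed

theorem theorem1p1:
  fixes P :: "(real ^ 'n::{finite,wellorder}) set" and d :: nat
  assumes "d = CARD('n)"
    and "P = avoidance_polytope {[1, 3, 2], [2, 1, 3]}"
  shows "combinatorially_equivalent P (unit_cube (d - 1) :: (real ^ 'n::{finite,wellorder}) set) \<and>
    normalized_volume difference_lattice P = 2 ^ (d - 1) * real d powi (int d - 3) \<and>
    lattice_equivalent P ((\<lambda>a. 2 *\<^sub>R a) ` (translated_chain_permutahedron :: (real ^ 'n::{finite,wellorder}) set))"
proof -
  have P: "P = slack_polytope" using assms(2) avoidance_polytope_eq_slack_polytope by simp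
  have "combinatorially_equivalent P (unit_cube (d - 1) :: (real, 'n) vec set)"
    unfolding P assms(1) by (rule combinatorially_equivalent_cube_like[OF cube_like_slack_polytope cube_like_unit_cube])
  moreover have "normalized_volume difference_lattice P = 2 ^ (d - 1) * real d powi (int d - 3)"
    unfolding P normalized_volume_slack_polytope assms(1)[symmetric]
    by (rule fact_times_cell_volume) (simp add: assms(1) Suc_leI)
  moreover have "lattice_equivalent P ((\<lambda>a. 2 *\<^sub>R a) ` (translated_chain_permutahedron :: (real, 'n) vec set))"
    unfolding P flip_slack_polytope[symmetric] by (rule lattice_equivalent_flip)
  ultimately show ?thesis by blast
qed

end
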